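(* Let $m,n\in\mathbb N$, and let $\alpha_i:(0,1]\to(0,1]$ ($i=1,\dots,m$) and $\beta_j:[1,\infty)\to[1,\infty)$ ($j=1,\dots,n$) be monotonically increasing bijections that are quasimultiplicative and satisfy $$\prod_{i=1}^m\alpha_i(1/T)=1/T\quad\text{and}\quad \prod_{j=1}^n\beta_j(T)=T\qquad\text{for all }T\ge1.$$ Then the set $\mathbf{BA}_{\vec\alpha,\vec\beta}$ of $(\vec\alpha,\vec\beta)$-badly approximable matrices is thick in $M_{m,n}$.
   Context: $M_{m,n}$ is the space of real $m\times n$ matrices; $\Theta_1,\dots,\Theta_m$ denote the rows of $\Theta\in M_{m,n}$; $\|x\|$ denotes the distance from $x\in\mathbb R$ to the nearest integer. An increasing function $h:I\to\mathbb R_{>0}$, where $I\subset\mathbb R_{>0}$ is an interval, is quasimultiplicative if there exist $R_0>1$ and $k_2\ge k_1>0$ such that $R^{k_1}h(T)\le h(RT)\le R^{k_2}h(T)$ for any $R\ge R_0$ and any $T>0$ with $T,RT\in I$. For a non-increasing function $f:[1,\infty)\to\mathbb R_{>0}$ tending to $0$ at infinity, $\Theta\in M_{m,n}$ is $(f,\vec\alpha,\vec\beta)$-approximable if the system $\|\Theta_i\mathbf q\|\le\alpha_i(f(T))$ ($i=1,\dots,m$), $|q_j|\le\beta_j(T)$ ($j=1,\dots,n$) has a nonzero solution $\mathbf q\in\mathbb Z^n$ for an unbounded set of $T$. With $f_1(T)=1/T$, the matrix $\Theta$ is $(\vec\alpha,\vec\beta)$-badly approximable if it is not $(\varepsilon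 f_1,\vec\alpha,\vec\beta)$-approximable for some $\varepsilon>0$. A subset of $M_{m,n}\cong\mathbb R^{mn}$ is thick if its intersection with every nonempty open set has Hausdorff dimension $mn$. *)

theory Defs
  imports "HOL-Analysis.Analysis"
begin

text \<open>Covers are by arbitrary bounded sets; boundedness is explicit because \<^const>\<open>diameter\<close>
  is only meaningful for bounded sets. The measure is used for \<open>s > 0\<close> only, so that
  sets of diameter \<open>0\<close> (in particular empty ones) contribute \<open>0 powr s = 0\<close>.\<close>

definition hausdorff_premeasure :: "real \<Rightarrow> real \<Rightarrow> 'a::metric_space set \<Rightarrow> ennreal" where
  "hausdorff_premeasure s \<delta> S =
     (INF U \<in> {U :: nat \<Rightarrow> 'a set. S \<subseteq> (\<Union>i. U i) \<and> (\<forall>i. bounded (U i) \<and> diameter (U i) \<le> \<delta>)}.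
        \<Sum>i. ennreal (diameter (U i) powr s))"

definition hausdorff_measure :: "real \<Rightarrow> 'a::metric_space set \<Rightarrow> ennreal" where
  "hausdorff_measure s S = (SUP \<delta> \<in> {0<..}. hausdorff_premeasure s \<delta> S)"

definition hausdorff_dim :: "'a::metric_space set \<Rightarrow> ennreal" where
  "hausdorff_dim S = Inf {ennreal s | s. s > 0 \<and> hausdorff_measure s S = 0}"

text \<open>An \<open>m \<times> n\<close> matrix has type \<^typ>\<open>real^'n^'m\<close>, with \<open>m = CARD('m)\<close> and \<open>n = CARD('n)\<close>;
  its distance is the Euclidean one on the \<open>mn\<close> entries.\<close>

definition thick :: "(real^'n^'m) set \<Rightarrow> bool" where
  "thick S \<longleftrightarrow>
     (\<forall>U. open U \<and> U \<noteq> {} \<longrightarrow> hausdorff_dim (S \<inter> U) = of_nat (CARD('m) * CARD('n)))"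

definition quasimultiplicative_on :: "real set \<Rightarrow> (real \<Rightarrow> real) \<Rightarrow> bool" where
  "quasimultiplicative_on I h \<longleftrightarrow>
     is_interval I \<and> I \<subseteq> {0<..} \<and> (\<forall>T\<in>I. h T > 0) \<and> mono_on I h \<and>
     (\<exists>R0 k1 k2. R0 > 1 \<and> k1 > 0 \<and> k2 \<ge> k1 \<and>
        (\<forall>R\<ge>R0. \<forall>T>0. T \<in> I \<and> R * T \<in> I \<longrightarrow>
           R powr k1 * h T \<le> h (R * T) \<and> h (R * T) \<le> R powr k2 * h T))"

definition dist_int :: "real \<Rightarrow> real" where
  "dist_int x = infdist x \<int>"

text \<open>Only the values of \<open>\<alpha> i\<close> on \<open>(0,1]\<close> and of \<open>\<beta> j\<close> and \<open>f\<close> on \<open>[1,\<infinity>)\<close> are meaningful.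
  The clause \<open>f T \<le> 1\<close> keeps \<open>f T\<close> in the domain of \<open>\<alpha> i\<close>; as \<open>f\<close> tends to \<open>0\<close>, it excludes only
  a bounded set of \<open>T\<close> and so does not affect unboundedness.\<close>

definition approximable ::
  "(real \<Rightarrow> real) \<Rightarrow> ('m \<Rightarrow> real \<Rightarrow> real) \<Rightarrow> ('n \<Rightarrow> real \<Rightarrow> real) \<Rightarrow> real^'n^'m \<Rightarrow> bool" where
  "approximable f \<alpha> \<beta> \<Theta> \<longleftrightarrow>
     \<not> bdd_above {T. T \<ge> 1 \<and> f T \<le> 1 \<and>
        (\<exists>q :: int^'n. q \<noteq> 0 \<and>
           (\<forall>i. dist_int (\<Sum>j\<in>UNIV. \<Theta> $ i $ j * of_int (q $ j)) \<le> \<alpha> i (f T)) \<and>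
           (\<forall>j. of_int \<bar>q $ j\<bar> \<le> \<beta> j T))}"

definition badly_approximable ::
  "('m \<Rightarrow> real \<Rightarrow> real) \<Rightarrow> ('n \<Rightarrow> real \<Rightarrow> real) \<Rightarrow> real^'n^'m \<Rightarrow> bool" where
  "badly_approximable \<alpha> \<beta> \<Theta> \<longleftrightarrow> (\<exists>\<epsilon>>0. \<not> approximable (\<lambda>T. \<epsilon> * (1 / T)) \<alpha> \<beta> \<Theta>)"

end

theory Submission
  imports Defs
begin

text \<open>
  Along the scales \<open>T\<^sub>k = R^k T\<^sub>0\<close> a matrix is badly approximable if the lattices obtained from \<open>\<int>^(m + n)\<close>
  by the shear \<open>\<Theta>\<close> and the dilations \<open>1 / \<alpha>\<^sub>i(1 / T\<^sub>k)\<close>, \<open>1 / \<beta>\<^sub>j(T\<^sub>k)\<close> have no nonzero vector of sup norm below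
  a fixed \<open>\<epsilon>\<close>. Start with a box of matrices with this property at scale \<open>T\<^sub>k\<close>, of side \<open>\<alpha>\<^sub>i(1 / T\<^sub>k) / \<beta>\<^sub>j(T\<^sub>k)\<close> in
  the entry \<open>(i, j)\<close>, and divide it into boxes of the sides belonging to \<open>R T\<^sub>k\<close>. A union bound over the lattice
  vectors that may become short shows that at least half of the smaller boxes inherit the property: a lattice of
  covolume one without vectors shorter than \<open>\<epsilon>\<close> has, in every box with long sides, at most a constant
  times the volume many points, with a constant that does not depend on \<open>\<epsilon>\<close>. So first \<open>\<epsilon>\<close> is taken
  small and then \<open>R\<close> large. The resulting Cantor set loses a bounded factor per step while its boxes
  shrink by a power of \<open>R\<close>, and its dimension tends to \<open>m n\<close> as \<open>R\<close> grows.\<close>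

section \<open>Hausdorff measure\<close>

text \<open>The weights let different entries shrink at different rates; only the products of the
  factors over rows and over columns are fixed, both being \<open>R\<close>. The boxes may be far
  from cubes, so all comparisons are made by volume: a covering ball is weighed against the volume
  left at a level where every side is at most its radius. No measure is put on the Cantor set. A
  cover of small total mass is dodged directly, by descending to a child on which it weighs no more
  than average. "Long sides" means sides above the covering radius of the lattice, and the available
  bound for that radius blows up as \<open>\<epsilon>\<close> tends to 0. Hence the lattice vectors
  split in two: those below the radius are bounded in number in terms of \<open>\<epsilon>\<close>
  and the dimensions, and a large \<open>R\<close> makes their share negligible; for the others the
  constant is free of \<open>\<epsilon>\<close>, so the factor \<open>\<epsilon> ^ (m + n)\<close>
  beats it before \<open>R\<close> is chosen.\<close>

lemma diameter_bounded_le: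
  fixes S :: "'a::metric_space set"
  assumes "\<And>x y. x \<in> S \<Longrightarrow> y \<in> S \<Longrightarrow> dist x y \<le> d" and "0 \<le> d"
  shows "bounded S \<and> diameter S \<le> d"
proof
  show "bounded S" using assms(1) unfolding bounded_two_points by blast
  show "diameter S \<le> d" using assms by (auto simp: diameter_def intro!: cSUP_least)
qed

text \<open>A mesh of \<open>L ^ n\<close> cells of diameter at most \<open>c / L\<close> has
  \<open>s\<close>-mass at most \<open>c powr s * L powr (n - s)\<close>, which tends to 0 because
  \<open>s > n\<close>.\<close>

lemma cube_cover:
  fixes \<delta> \<eta> s :: real and a :: nat
  assumes s: "real DIM('a::euclidean_space) < s" and "0 < \<delta>" "0 < \<eta>"
  shows "\<exists>V :: nat \<Rightarrow> 'a set. {x. \<forall>b\<in>Basis. \<bar>x \<bullet> b\<bar> \<le> real a} \<subseteq> (\<Union>i. V i)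
    \<and> (\<forall>i. bounded (V i) \<and> diameter (V i) \<le> \<delta>) \<and> (\<Sum>i. ennreal (diameter (V i) powr s)) \<le> ennreal \<eta>"
proof -
  define n where "n = DIM('a)"
  \<comment> \<open>\<open>2 * a + 1\<close> exceeds the side of the cube, so the mesh width is
    positive even for \<open>a = 0\<close> and every digit is strictly below \<open>L\<close>. The
    factor \<open>n\<close> comes from bounding the norm by the l1 norm.\<close>
  define c where "c = real n * (2 * real a + 1)"
  have n0: "0 < n" by (simp add: n_def)
  have c0: "0 < c" using n0 by (simp add: c_def)
  have "((\<lambda>L. c powr s * real L powr (real n - s)) \<longlongrightarrow> c powr s * 0) sequentially"
    using s by (intro tendsto_mult tendsto_const tendsto_neg_powr filterlim_real_sequentially) (auto simp: n_def)
  then have "\<forall>\<^sub>F L in sequentially. c powr s * real L powr (real n - s) < \<eta>"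
    using \<open>0 < \<eta>\<close> by (intro order_tendstoD) auto
  moreover have "\<forall>\<^sub>F L in sequentially. c / real L < \<delta>"
    using \<open>0 < \<delta>\<close> lim_const_over_n[of c] by (intro order_tendstoD) auto
  moreover have "\<forall>\<^sub>F L in sequentially. 0 < L" by (rule eventually_gt_at_top)
  ultimately have "\<forall>\<^sub>F L in sequentially. c powr s * real L powr (real n - s) < \<eta> \<and> c / real L < \<delta> \<and> 0 < L"
    by eventually_elim auto
  then obtain L where L: "c powr s * real L powr (real n - s) < \<eta>" "c / real L < \<delta>" "0 < L"
    by (auto dest!: eventually_happens)
  define h where "h = (2 * real a + 1) / real L"
  have h0: "0 < h" using L by (simp add: h_def)
  define F where "F = PiE (Basis::'a set) (\<lambda>_. {..<L})"
  have finF: "finite F" and cardF: "card F = L ^ n" by (simp_all add: F_def finite_PiE card_PiE n_def)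
  obtain f where f: "bij_betw f {..<L ^ n} F"
    using ex_bij_betw_nat_finite[OF finF] by (auto simp: cardF atLeast0LessThan)
  define Q where "Q D = {x::'a. \<forall>b\<in>Basis. - real a + real (D b) * h \<le> x \<bullet> b \<and> x \<bullet> b \<le> - real a + real (D b) * h + h}"
    for D :: "'a \<Rightarrow> nat"
  have diamQ: "bounded (Q D) \<and> diameter (Q D) \<le> c / real L" for D
  proof (rule diameter_bounded_le)
    fix x y assume xy: "x \<in> Q D" "y \<in> Q D"
    have "dist x y \<le> (\<Sum>b\<in>Basis. \<bar>(x - y) \<bullet> b\<bar>)" unfolding dist_norm by (rule norm_le_l1)
    also have "\<dots> \<le> (\<Sum>b\<in>(Basis::'a set). h)"
    proof (rule sum_mono)
      fix b :: 'a assume "b \<in> Basis"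
      then show "\<bar>(x - y) \<bullet> b\<bar> \<le> h" using xy by (auto simp: Q_def inner_diff_left dest!: bspec)
    qed
    also have "\<dots> = c / real L" by (simp add: h_def c_def n_def)
    finally show "dist x y \<le> c / real L" .
  qed (use c0 in auto)
  define V where "V i = (if i < L ^ n then Q (f i) else {})" for i
  have "{x. \<forall>b\<in>Basis. \<bar>x \<bullet> b\<bar> \<le> real a} \<subseteq> (\<Union>i. V i)"
  proof
    fix x :: 'a assume x: "x \<in> {x. \<forall>b\<in>Basis. \<bar>x \<bullet> b\<bar> \<le> real a}"
    define D where "D = (\<lambda>b\<in>Basis. nat \<lfloor>(x \<bullet> b + real a) / h\<rfloor>)"
    have D: "D b < L \<and> - real a + real (D b) * h \<le> x \<bullet> b \<and> x \<bullet> b \<le> - real a + real (D b) * h + h"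
      if b: "b \<in> Basis" for b
    proof -
      define y where "y = (x \<bullet> b + real a) / h"
      have xb: "\<bar>x \<bullet> b\<bar> \<le> real a" using x b by auto
      then have y0: "0 \<le> y" using h0 by (simp add: y_def)
      have Db: "real (D b) \<le> y" "y \<le> real (D b) + 1" using y0 b by (auto simp: D_def y_def)
      have yh: "y * h = x \<bullet> b + real a" using h0 by (simp add: y_def)
      have "y * h < real L * h" using xb L(3) unfolding yh by (simp add: h_def)
      then have "y < real L" using h0 by simp
      then have "D b < L" using Db(1) by simp
      moreover have "real (D b) * h \<le> y * h" "y * h \<le> (real (D b) + 1) * h"
        using Db h0 by (auto intro!: mult_right_mono)
      ultimately show ?thesis unfolding yh by (simp add: algebra_simps)
    qed
    then have "D \<in> F" by (auto simp: F_def D_def)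
    then obtain i where "i < L ^ n" "f i = D" using f by (auto simp: bij_betw_def)
    moreover have "x \<in> Q D" using D by (auto simp: Q_def)
    ultimately show "x \<in> (\<Union>i. V i)" by (auto simp: V_def intro!: exI[of _ i])
  qed
  moreover have "bounded (V i) \<and> diameter (V i) \<le> \<delta>" for i
    using diamQ[of "f i"] L(2) \<open>0 < \<delta>\<close> by (auto simp: V_def)
  moreover have "(\<Sum>i. ennreal (diameter (V i) powr s)) \<le> ennreal \<eta>"
  proof -
    have "(\<Sum>i. ennreal (diameter (V i) powr s)) = (\<Sum>i<L ^ n. ennreal (diameter (V i) powr s))"
      by (rule suminf_finite) (auto simp: V_def)
    also have "\<dots> \<le> (\<Sum>i<L ^ n. ennreal ((c / real L) powr s))"
      using diamQ s n0 by (intro sum_mono ennreal_leI powr_mono2) (auto simp: V_def n_def diameter_ge_0)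
    also have "\<dots> = ennreal (real (L ^ n) * (c / real L) powr s)"
      by (simp add: ennreal_mult' ennreal_of_nat_eq_real_of_nat)
    also have "real (L ^ n) * (c / real L) powr s = c powr s * real L powr (real n - s)"
      using L(3) c0 by (simp add: powr_divide powr_diff powr_realpow)
    also have "ennreal \<dots> \<le> ennreal \<eta>" using L(1) by (intro ennreal_leI) auto
    finally show ?thesis .
  qed
  ultimately show ?thesis by blast
qed

text \<open>The cube of half-side \<open>a\<close> is covered at cost
  \<open>\<eta> / 2 ^ (a + 1)\<close>; the countably many covers are merged by
  \<open>prod_decode\<close>.\<close>

lemma hausdorff_measure_eq_0:
  fixes S :: "'a::euclidean_space set"
  assumes s: "real DIM('a) < s"
  shows "hausdorff_measure s S = 0"
proof -
  have le: "hausdorff_premeasure s \<delta> S \<le> 0 + ennreal \<eta>" if "0 < \<delta>" "0 < \<eta>" for \<delta> \<eta>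
  proof -
    have "\<exists>V :: nat \<Rightarrow> 'a set. {x. \<forall>b\<in>Basis. \<bar>x \<bullet> b\<bar> \<le> real a} \<subseteq> (\<Union>i. V i)
      \<and> (\<forall>i. bounded (V i) \<and> diameter (V i) \<le> \<delta>)
      \<and> (\<Sum>i. ennreal (diameter (V i) powr s)) \<le> ennreal (\<eta> * (1 / 2) ^ Suc a)" for a
      using that by (intro cube_cover[OF s]) auto
    then have "\<exists>V. \<forall>a. {x. \<forall>b\<in>Basis. \<bar>x \<bullet> b\<bar> \<le> real a} \<subseteq> (\<Union>i. V a i)
      \<and> (\<forall>i. bounded (V a i :: 'a set) \<and> diameter (V a i) \<le> \<delta>)
      \<and> (\<Sum>i. ennreal (diameter (V a i) powr s)) \<le> ennreal (\<eta> * (1 / 2) ^ Suc a)"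
      by (intro choice allI)
    then obtain V :: "nat \<Rightarrow> nat \<Rightarrow> 'a set" where
      V: "\<And>a. {x. \<forall>b\<in>Basis. \<bar>x \<bullet> b\<bar> \<le> real a} \<subseteq> (\<Union>i. V a i)"
        "\<And>a i. bounded (V a i) \<and> diameter (V a i) \<le> \<delta>"
        "\<And>a. (\<Sum>i. ennreal (diameter (V a i) powr s)) \<le> ennreal (\<eta> * (1 / 2) ^ Suc a)"
      by blast
    define U where "U i = (case prod_decode i of (a, j) \<Rightarrow> V a j)" for i
    have "S \<subseteq> (\<Union>i. U i)"
    proof
      fix x :: 'a
      obtain a :: nat where a: "norm x \<le> real a" using real_arch_simple by blast
      have "\<forall>b\<in>Basis. \<bar>x \<bullet> b\<bar> \<le> real a" using a by (meson Basis_le_norm order_trans)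
      then obtain j where "x \<in> V a j" using V(1)[of a] by auto
      then show "x \<in> (\<Union>i. U i)" by (intro UN_I[of "prod_encode (a, j)"]) (auto simp: U_def)
    qed
    moreover have "bounded (U i) \<and> diameter (U i) \<le> \<delta>" for i
      using V(2) by (simp add: U_def split: prod.split)
    ultimately have "hausdorff_premeasure s \<delta> S \<le> (\<Sum>i. ennreal (diameter (U i) powr s))"
      unfolding hausdorff_premeasure_def by (intro INF_lower) auto
    also have "\<dots> = (\<Sum>a. \<Sum>j. ennreal (diameter (V a j) powr s))"
      using suminf_ennreal_2dimen[of _ "\<lambda>(a, j). ennreal (diameter (V a j) powr s)", OF refl]
      by (simp add: U_def case_prod_beta)
    also have "\<dots> \<le> (\<Sum>a. ennreal (\<eta> * (1 / 2) ^ Suc a))"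
      by (intro suminf_le V(3)) auto
    also have "\<dots> = ennreal (\<Sum>a. \<eta> * (1 / 2) ^ Suc a)"
      using that sums_mult[OF power_half_series, of \<eta>] by (intro suminf_ennreal2) (auto simp: sums_iff)
    also have "(\<Sum>a. \<eta> * (1 / 2) ^ Suc a) = \<eta>"
      using sums_mult[OF power_half_series, of \<eta>] by (simp add: sums_iff)
    finally show ?thesis by simp
  qed
  have "hausdorff_premeasure s \<delta> S \<le> 0" if "0 < \<delta>" for \<delta>
    by (rule ennreal_le_epsilon) (rule le[OF that])
  then have "hausdorff_measure s S \<le> 0"
    unfolding hausdorff_measure_def by (intro SUP_least) simp
  then show ?thesis by simp
qed

text \<open>Sets of diameter 0 must still receive a positive radius, since later a level is sought
  at which all box sides are at most that radius. The enlargement is paid for by a geometric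
  series.\<close>

lemma null_set_cover:
  fixes S :: "'a::metric_space set"
  assumes S: "hausdorff_measure s S = 0" and s: "0 < s" and \<eta>: "0 < \<eta>" "\<eta> \<le> 1"
  obtains c :: "nat \<Rightarrow> 'a" and r :: "nat \<Rightarrow> real"
  where "\<And>i. 0 < r i" "\<And>i. r i \<le> 1" "summable (\<lambda>i. r i powr s)" "(\<Sum>i. r i powr s) < \<eta>"
    "S \<subseteq> (\<Union>i. cball (c i) (r i))"
proof -
  have "hausdorff_premeasure s 1 S \<le> hausdorff_measure s S"
    unfolding hausdorff_measure_def by (intro SUP_upper) auto
  then have "hausdorff_premeasure s 1 S < ennreal (\<eta> / 2)" using S \<eta> by auto
  then obtain U where U: "S \<subseteq> (\<Union>i. U i)" "\<And>i. bounded (U i)" "\<And>i. diameter (U i) \<le> 1"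
    and less: "(\<Sum>i. ennreal (diameter (U i) powr s)) < ennreal (\<eta> / 2)"
    unfolding hausdorff_premeasure_def INF_less_iff by auto
  have summ: "summable (\<lambda>i. diameter (U i) powr s)"
    using less by (intro summable_suminf_not_top) auto
  have lt: "(\<Sum>i. diameter (U i) powr s) < \<eta> / 2"
    using less summ by (simp add: suminf_ennreal2 ennreal_less_iff suminf_nonneg)
  \<comment> \<open>The exponent \<open>1 / s\<close> makes the \<open>s\<close>-masses of these
    radii sum to \<open>\<eta> / 2\<close>, the half left over by the cover
    \<open>U\<close>.\<close>
  define \<rho> where "\<rho> i = (\<eta> / 2 * (1 / 2) ^ Suc i) powr (1 / s)" for i
  have \<rho>0: "0 < \<rho> i" for i using \<eta> by (simp add: \<rho>_def)
  have \<rho>s: "\<rho> i powr s = \<eta> / 2 * (1 / 2) ^ Suc i" for i using \<eta> s by (simp add: \<rho>_def powr_powr)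
  have \<rho>1: "\<rho> i \<le> 1" for i
  proof -
    have "(1 / 2 :: real) ^ Suc i \<le> 1" by (intro power_le_one) auto
    then have "\<eta> / 2 * (1 / 2) ^ Suc i \<le> 1 * 1" using \<eta> by (intro mult_mono) auto
    then show ?thesis unfolding \<rho>_def using \<eta> s by (intro powr_le1) auto
  qed
  define r where "r i = max (diameter (U i)) (\<rho> i)" for i
  have r_le: "r i powr s \<le> diameter (U i) powr s + \<rho> i powr s" for i
    by (auto simp: r_def max_def)
  have \<rho>_sums: "(\<lambda>i. \<rho> i powr s) sums (\<eta> / 2)"
    using sums_mult[OF power_half_series, of "\<eta> / 2"] by (simp add: \<rho>s)
  have summ2: "summable (\<lambda>i. diameter (U i) powr s + \<rho> i powr s)"
    using summ \<rho>_sums by (intro summable_add) (auto simp: sums_iff)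
  have summr: "summable (\<lambda>i. r i powr s)"
    by (rule summable_comparison_test'[OF summ2, of 0]) (use r_le in auto)
  have "(\<Sum>i. r i powr s) \<le> (\<Sum>i. diameter (U i) powr s + \<rho> i powr s)"
    by (intro suminf_le r_le summr summ2)
  also have "\<dots> = (\<Sum>i. diameter (U i) powr s) + \<eta> / 2"
    using summ \<rho>_sums by (subst suminf_add[symmetric]) (auto simp: sums_iff)
  also have "\<dots> < \<eta>" using lt by simp
  finally have "(\<Sum>i. r i powr s) < \<eta>" .
  moreover define c where "c i = (SOME x. x \<in> U i)" for i
  have "S \<subseteq> (\<Union>i. cball (c i) (r i))"
  proof
    fix x assume "x \<in> S"
    then obtain i where i: "x \<in> U i" using U(1) by auto
    then have "c i \<in> U i" unfolding c_def by (rule someI)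
    then have "dist (c i) x \<le> diameter (U i)" using i U(2) by (intro diameter_bounded_bound)
    then have "x \<in> cball (c i) (r i)" by (simp add: r_def)
    then show "x \<in> (\<Union>i. cball (c i) (r i))" by blast
  qed
  moreover have "0 < r i" "r i \<le> 1" for i using \<rho>0[of i] \<rho>1[of i] U(3)[of i] by (auto simp: r_def)
  ultimately show ?thesis using that summr by blast
qed

section \<open>Nested boxes avoiding a cover\<close>

definition digits :: "('e \<Rightarrow> nat) \<Rightarrow> ('e \<Rightarrow> nat) set" where
  "digits N = PiE UNIV (\<lambda>e. {..<N e})"

lemma finite_digits [simp]: "finite (digits (N :: 'e::finite \<Rightarrow> nat))"
  by (simp add: digits_def finite_PiE)

text \<open>All boxes of a level share their sides, so a box is represented by its lower corner
  alone; \<open>w\<close> holds the sides of the child.\<close>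

definition child :: "('e \<Rightarrow> real) \<Rightarrow> ('e \<Rightarrow> real) \<Rightarrow> ('e \<Rightarrow> nat) \<Rightarrow> 'e \<Rightarrow> real" where
  "child x w D = (\<lambda>e. x e + real (D e) * w e)"

text \<open>Projection to the interval of radius \<open>r\<close> around \<open>u\<close>. The
  difference of its values at the ends of an interval is the length of the common part, without case
  distinctions, and such differences telescope.\<close>

definition clamp_to :: "real \<Rightarrow> real \<Rightarrow> real \<Rightarrow> real" where
  "clamp_to u r y = max (u - r) (min y (u + r))"

lemma clamp_to_mono: "y \<le> z \<Longrightarrow> clamp_to u r y \<le> clamp_to u r z"
  by (auto simp: clamp_to_def)

text \<open>The volume of the box with corner \<open>x\<close> and sides \<open>w\<close> intersected with the cube of radius \<open>r\<close> around \<open>u\<close>.\<close>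

definition overlap :: "('e::finite \<Rightarrow> real) \<Rightarrow> real \<Rightarrow> ('e \<Rightarrow> real) \<Rightarrow> ('e \<Rightarrow> real) \<Rightarrow> real" where
  "overlap u r x w = (\<Prod>e\<in>UNIV. clamp_to (u e) r (x e + w e) - clamp_to (u e) r (x e))"

lemma overlap_nonneg: "(\<And>e. 0 \<le> w e) \<Longrightarrow> 0 \<le> overlap u r x w"
  unfolding overlap_def by (intro prod_nonneg ballI) (simp add: clamp_to_mono)

lemma overlap_le:
  fixes u :: "'e::finite \<Rightarrow> real"
  assumes "\<And>e. 0 \<le> w e" and "0 \<le> r"
  shows "overlap u r x w \<le> (2 * r) ^ CARD('e)"
proof -
  have "overlap u r x w \<le> (\<Prod>e\<in>(UNIV::'e set). 2 * r)"
    unfolding overlap_def using assms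
    by (intro prod_mono conjI) (auto simp: clamp_to_mono, auto simp: clamp_to_def)
  then show ?thesis by simp
qed

text \<open>The sum over digit vectors of a product over coordinates factors into one telescoping
  sum per coordinate. It is an inequality because the \<open>N e\<close> pieces may leave a
  remainder of the side.\<close>

lemma sum_overlap_children:
  fixes u :: "'e::finite \<Rightarrow> real"
  assumes "\<And>e. 0 \<le> w' e" and "\<And>e. real (N e) * w' e \<le> w e"
  shows "(\<Sum>D\<in>digits N. overlap u r (child x w' D) w') \<le> overlap u r x w"
proof -
  have "(\<Sum>D\<in>digits N. overlap u r (child x w' D) w') =
    (\<Prod>e\<in>UNIV. \<Sum>d<N e. clamp_to (u e) r (x e + real (Suc d) * w' e) - clamp_to (u e) r (x e + real d * w' e))"
    unfolding digits_def overlap_def child_def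
    by (subst prod_sum_PiE) (auto simp: algebra_simps)
  also have "\<dots> = (\<Prod>e\<in>UNIV. clamp_to (u e) r (x e + real (N e) * w' e) - clamp_to (u e) r (x e))"
    by (intro prod.cong refl, subst sum_lessThan_telescope) simp
  also have "\<dots> \<le> overlap u r x w"
    unfolding overlap_def using assms
    by (intro prod_mono conjI) (auto intro!: clamp_to_mono diff_right_mono)
  finally show ?thesis .
qed

text \<open>The weighted volume \<open>V\<close> of the covering cubes inside the current box is a super-additive function
  of the box, so some good child carries at most the average share of it. A cube that still met
  the box at its own level \<open>\<kappa> i\<close> would contribute its full weight.\<close>

lemma nested_boxes_avoid:
  fixes w :: "nat \<Rightarrow> 'e::finite \<Rightarrow> real" and N :: "nat \<Rightarrow> 'e \<Rightarrow> nat"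
    and u :: "nat \<Rightarrow> 'e \<Rightarrow> real" and r W :: "nat \<Rightarrow> real" and \<kappa> :: "nat \<Rightarrow> nat"
  assumes w_pos: "\<And>k e. 0 < w k e"
    and N_w: "\<And>k e. real (N k e) * w (Suc k) e \<le> w k e"
    and M_pos: "\<And>k. 0 < M k"
    and root: "G 0 x0"
    and children: "\<And>k x. G k x \<Longrightarrow> M k \<le> real (card {D \<in> digits (N k). G (Suc k) (child x (w (Suc k)) D)})"
    and \<kappa>: "\<And>i e. w (\<kappa> i) e \<le> r i"
    and W: "\<And>i. W i = (\<Prod>e\<in>UNIV. w (\<kappa> i) e) * (\<Prod>l<\<kappa> i. M l)"
    and summ: "summable (\<lambda>i. (4 * r i) ^ CARD('e) / W i)"
    and small: "(\<Sum>i. (4 * r i) ^ CARD('e) / W i) < 1"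
  shows "\<exists>z x. x 0 = x0 \<and> (\<forall>k. G k (x k) \<and> (\<forall>e. x k e \<le> z e \<and> z e \<le> x k e + w k e))
    \<and> (\<forall>i. \<exists>e. r i < \<bar>z e - u i e\<bar>)"
proof -
  \<comment> \<open>The radius is doubled because a box of sides at most \<open>r i\<close> that
    meets the cube of radius \<open>r i\<close> lies in the cube of radius \<open>2 * r i\<close>,
    and so overlaps it in its full volume.\<close>
  define V where "V k x i = overlap (u i) (2 * r i) x (w k) / W i" for k x i
  define \<Phi> where "\<Phi> k x = (\<Sum>i. V k x i)" for k x
  have r0: "0 < r i" for i using w_pos[of "\<kappa> i" undefined] \<kappa>[of i undefined] by linarith
  have W0: "0 < W i" for i unfolding W by (intro mult_pos_pos prod_pos) (auto simp: w_pos M_pos)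
  have V0: "0 \<le> V k x i" for k x i
    unfolding V_def using W0 by (intro divide_nonneg_pos overlap_nonneg) (auto simp: w_pos less_imp_le)
  have V_le: "V k x i \<le> (4 * r i) ^ CARD('e) / W i" for k x i
    unfolding V_def using overlap_le[of "w k" "2 * r i" "u i" x] W0 r0
    by (intro divide_right_mono) (auto simp: w_pos less_imp_le)
  have V_summ: "summable (V k x)" for k x
    by (rule summable_comparison_test'[OF summ, of 0]) (use V_le V0 in auto)
  have \<Phi>0: "0 \<le> \<Phi> k x" for k x unfolding \<Phi>_def by (intro suminf_nonneg V_summ V0)
  define C where "C k x = {D \<in> digits (N k). G (Suc k) (child x (w (Suc k)) D)}" for k x
  have step: "\<exists>D\<in>C k x. M k * \<Phi> (Suc k) (child x (w (Suc k)) D) \<le> \<Phi> k x" if G: "G k x" for k x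
  proof (rule ccontr)
    let ?c = "child x (w (Suc k))"
    assume "\<not> ?thesis"
    then have less: "\<Phi> k x < M k * \<Phi> (Suc k) (?c D)" if "D \<in> C k x" for D using that by auto
    have fin: "finite (C k x)" by (simp add: C_def)
    have card: "M k \<le> real (card (C k x))" using children[OF G] by (simp add: C_def)
    then have ne: "C k x \<noteq> {}" using M_pos[of k] by (auto)
    have "M k * \<Phi> k x \<le> real (card (C k x)) * \<Phi> k x" using card \<Phi>0 by (rule mult_right_mono)
    also have "\<dots> = (\<Sum>D\<in>C k x. \<Phi> k x)" by simp
    also have "\<dots> < (\<Sum>D\<in>C k x. M k * \<Phi> (Suc k) (?c D))"
      by (intro sum_strict_mono fin ne less)
    also have "\<dots> = M k * (\<Sum>D\<in>C k x. \<Phi> (Suc k) (?c D))" by (simp add: sum_distrib_left)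
    also have "(\<Sum>D\<in>C k x. \<Phi> (Suc k) (?c D)) = (\<Sum>i. \<Sum>D\<in>C k x. V (Suc k) (?c D) i)"
      unfolding \<Phi>_def by (rule suminf_sum[symmetric]) (rule V_summ)
    also have "\<dots> \<le> \<Phi> k x" unfolding \<Phi>_def
    proof (rule suminf_le)
      fix i
      have "(\<Sum>D\<in>C k x. V (Suc k) (?c D) i) \<le> (\<Sum>D\<in>digits (N k). V (Suc k) (?c D) i)"
        by (intro sum_mono2) (auto simp: C_def V0)
      also have "\<dots> = (\<Sum>D\<in>digits (N k). overlap (u i) (2 * r i) (?c D) (w (Suc k))) / W i"
        by (simp add: V_def sum_divide_distrib)
      also have "\<dots> \<le> V k x i"
        unfolding V_def using w_pos N_w W0
        by (intro divide_right_mono sum_overlap_children) (auto intro: less_imp_le)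
      finally show "(\<Sum>D\<in>C k x. V (Suc k) (?c D) i) \<le> V k x i" .
    qed (auto intro: summable_sum V_summ)
    finally show False using M_pos[of k] by simp
  qed
  \<comment> \<open>The product of the \<open>M l\<close> is a lower bound for the number of
    surviving boxes, and the invariant keeps the weight of the cover below its reciprocal. By the
    choice of \<open>W i\<close>, a cube still met at level \<open>\<kappa> i\<close> would alone
    weigh exactly that reciprocal.\<close>
  define P where "P k x \<longleftrightarrow> G k x \<and> (\<Prod>l<k. M l) * \<Phi> k x < 1" for k x
  define Q where "Q k x y \<longleftrightarrow> (\<exists>D\<in>digits (N k). y = child x (w (Suc k)) D)" for k x y
  have "\<exists>x. \<forall>k. (P k (x k) \<and> (k = 0 \<longrightarrow> x k = x0)) \<and> Q k (x k) (x (Suc k))"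
  proof (rule dependent_nat_choice)
    have "\<Phi> 0 x0 \<le> (\<Sum>i. (4 * r i) ^ CARD('e) / W i)"
      unfolding \<Phi>_def by (rule suminf_le[OF V_le V_summ summ])
    then have "P 0 x0" using root small by (simp add: P_def)
    then show "\<exists>x. P 0 x \<and> (0 = 0 \<longrightarrow> x = x0)" by blast
  next
    fix x k assume "P k x \<and> (k = 0 \<longrightarrow> x = x0)"
    then have G: "G k x" and lt: "(\<Prod>l<k. M l) * \<Phi> k x < 1" by (auto simp: P_def)
    obtain D where D: "D \<in> C k x" "M k * \<Phi> (Suc k) (child x (w (Suc k)) D) \<le> \<Phi> k x"
      using step[OF G] by blast
    have "(\<Prod>l<Suc k. M l) * \<Phi> (Suc k) (child x (w (Suc k)) D)
        = (\<Prod>l<k. M l) * (M k * \<Phi> (Suc k) (child x (w (Suc k)) D))"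
      by simp
    also have "\<dots> \<le> (\<Prod>l<k. M l) * \<Phi> k x"
      using D(2) M_pos by (intro mult_left_mono prod_nonneg) (auto intro: less_imp_le)
    finally have "P (Suc k) (child x (w (Suc k)) D)" using D(1) lt by (simp add: P_def C_def)
    then show "\<exists>y. (P (Suc k) y \<and> (Suc k = 0 \<longrightarrow> y = x0)) \<and> Q k x y"
      using D(1) by (auto simp: Q_def C_def)
  qed
  then obtain x where x: "\<And>k. P k (x k)" "x 0 = x0" "\<And>k. Q k (x k) (x (Suc k))" by blast
  have nest: "x k e \<le> x (Suc k) e \<and> x (Suc k) e + w (Suc k) e \<le> x k e + w k e" for k e
  proof -
    obtain D where D: "D \<in> digits (N k)" "x (Suc k) = child (x k) (w (Suc k)) D"
      using x(3)[of k] by (auto simp: Q_def)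
    have "real (D e) + 1 \<le> real (N k e)"
      using D(1) by (auto simp: digits_def PiE_UNIV_domain Pi_iff nat_less_real_le)
    then have "(real (D e) + 1) * w (Suc k) e \<le> real (N k e) * w (Suc k) e"
      using w_pos[of "Suc k" e] by (intro mult_right_mono) auto
    then show ?thesis using N_w[of k e] w_pos[of "Suc k" e] by (simp add: D(2) child_def algebra_simps)
  qed
  have mono: "x k e \<le> x l e \<and> x l e + w l e \<le> x k e + w k e" if "k \<le> l" for k l e
    using that
  proof (induction l rule: dec_induct)
    case (step l) then show ?case using nest[of l e] by linarith
  qed simp
  \<comment> \<open>Every lower corner lies below every upper corner, also across levels; hence the
    supremum of the lower corners is in all boxes.\<close>
  have upper: "x k e \<le> x l e + w l e" for k l e
    using mono[of k "max k l" e] mono[of l "max k l" e] w_pos[of "max k l" e] by auto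
  define z where "z e = (SUP k. x k e)" for e
  have bdd: "bdd_above (range (\<lambda>k. x k e))" for e using upper[of _ e 0] by (auto intro!: bdd_aboveI)
  have z1: "x k e \<le> z e" for k e unfolding z_def by (rule cSUP_upper[OF _ bdd]) simp
  have z2: "z e \<le> x k e + w k e" for k e unfolding z_def by (rule cSUP_least) (auto intro: upper)
  have "\<exists>e. r i < \<bar>z e - u i e\<bar>" for i
  proof (rule ccontr)
    assume "\<not> ?thesis"
    then have cl: "\<bar>z e - u i e\<bar> \<le> r i" for e by (simp add: not_less)
    let ?k = "\<kappa> i"
    have "clamp_to (u i e) (2 * r i) (x ?k e + w ?k e) - clamp_to (u i e) (2 * r i) (x ?k e) = w ?k e" for e
      using cl[of e] z1[of ?k e] z2[of e ?k] \<kappa>[of i e] w_pos[of ?k e] by (simp add: clamp_to_def)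
    then have "overlap (u i) (2 * r i) (x ?k) (w ?k) = (\<Prod>e\<in>UNIV. w ?k e)" by (simp add: overlap_def)
    moreover have "(\<Prod>e\<in>UNIV. w ?k e) \<noteq> 0" using w_pos by (auto simp: less_le prod_zero_iff) 
    ultimately have "(\<Prod>l<?k. M l) * V ?k (x ?k) i = 1"
      using M_pos by (simp add: V_def W prod_zero_iff less_le)
    moreover have "V ?k (x ?k) i \<le> \<Phi> ?k (x ?k)"
      unfolding \<Phi>_def using sum_le_suminf[OF V_summ, of "{i}" ?k "x ?k"] V0 by auto
    ultimately have "1 \<le> (\<Prod>l<?k. M l) * \<Phi> ?k (x ?k)"
      using mult_left_mono[of "V ?k (x ?k) i" "\<Phi> ?k (x ?k)" "\<Prod>l<?k. M l"] M_pos
      by (auto simp: prod_nonneg less_imp_le)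
    then show False using x(1)[of ?k] by (auto simp: P_def)
  qed
  then show ?thesis using x z1 z2 by (intro exI[of _ z] exI[of _ x]) (auto simp: P_def)
qed

section \<open>Lattice points in boxes\<close>

lemma ex_argmax:
  fixes f :: "'i::finite \<Rightarrow> real"
  shows "\<exists>k. \<forall>i. f i \<le> f k"
proof -
  have "Max (range f) \<in> range f" by (intro Max_in) auto
  then obtain k where "Max (range f) = f k" by blast
  then show ?thesis by (metis Max_ge finite finite_imageI rangeI)
qed

lemma card_le_spread:
  fixes S :: "int set"
  assumes "\<And>k l. k \<in> S \<Longrightarrow> l \<in> S \<Longrightarrow> real_of_int (k - l) \<le> L" and "0 \<le> L"
  shows "finite S \<and> real (card S) \<le> L + 1"
proof (cases "S = {}")
  case True
  then show ?thesis using assms by auto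
next
  case False
  then obtain k where k: "k \<in> S" by auto
  have sub: "S \<subseteq> {k - \<lceil>L\<rceil> .. k + \<lceil>L\<rceil>}"
  proof
    fix l assume "l \<in> S"
    with assms(1)[OF k this] assms(1)[OF this k] show "l \<in> {k - \<lceil>L\<rceil> .. k + \<lceil>L\<rceil>}"
      by (auto; linarith)
  qed
  then have fin: "finite S" by (rule finite_subset) auto
  have "S \<subseteq> {Min S .. Max S}" using fin by auto
  then have "card S \<le> card {Min S .. Max S}" by (intro card_mono) auto
  also have "card {Min S .. Max S} = nat (Max S - Min S + 1)" by simp
  finally have "real (card S) \<le> real_of_int (Max S - Min S) + 1"
    using Max_ge[OF fin Min_in[OF fin False]] by linarith
  moreover have "real_of_int (Max S - Min S) \<le> L"
    using fin False by (intro assms(1)) auto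
  ultimately show ?thesis using fin by linarith
qed

lemma card_int_interval:
  fixes c h :: real
  assumes "1 \<le> h"
  shows "finite {k::int. \<bar>c + k\<bar> \<le> h} \<and> h \<le> real (card {k::int. \<bar>c + k\<bar> \<le> h})
    \<and> real (card {k::int. \<bar>c + k\<bar> \<le> h}) \<le> 3 * h"
proof -
  have eq: "{k::int. \<bar>c + k\<bar> \<le> h} = {\<lceil>- h - c\<rceil> .. \<lfloor>h - c\<rfloor>}"
    by (auto simp: ceiling_le_iff le_floor_iff abs_le_iff)
  have "real_of_int (\<lfloor>h - c\<rfloor> - \<lceil>- h - c\<rceil> + 1) \<ge> h" "real_of_int (\<lfloor>h - c\<rfloor> - \<lceil>- h - c\<rceil> + 1) \<le> 3 * h"
    using assms by linarith+
  then show ?thesis unfolding eq using assms by auto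
qed

lemma half_le_nat_floor:
  fixes y :: real
  assumes "1 \<le> y"
  shows "y / 2 \<le> real (nat \<lfloor>y\<rfloor>)"
proof -
  have "1 \<le> \<lfloor>y\<rfloor>" using assms by simp
  then have "y / 2 \<le> of_int \<lfloor>y\<rfloor>" by linarith
  then show ?thesis using assms by simp
qed

section \<open>Lattices described by point density: short spanning vectors, covering radius, points
  in boxes\<close>

definition cube_points :: "(real^'d) set \<Rightarrow> ('d \<Rightarrow> real) \<Rightarrow> (real^'d) set" where
  "cube_points \<Lambda> S = {v \<in> \<Lambda>. \<forall>i. \<bar>v $ i\<bar> \<le> S i}"

text \<open>The bracket is the size of lattice vectors that span the space, from
  \<open>span_bounded\<close>; rounding coefficients in a basis of \<open>d\<close> such vectors
  costs at most \<open>d\<close> times as much.\<close>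

definition covering_radius :: "nat \<Rightarrow> real \<Rightarrow> real" where
  "covering_radius d \<epsilon> = real d * ((5 * real d) ^ d / (\<epsilon> / real d) ^ (d - 1) + \<epsilon>)"

lemma covering_radius_pos: "0 < d \<Longrightarrow> 0 < \<epsilon> \<Longrightarrow> 0 < covering_radius d \<epsilon>"
  unfolding covering_radius_def by (intro mult_pos_pos add_nonneg_pos divide_nonneg_nonneg) auto

text \<open>The two density conditions say that the lattice has covolume of order one.\<close>

locale unimodular_lattice =
  fixes \<Lambda> :: "(real^'d::finite) set" and \<epsilon> t0 :: real
  assumes zero: "0 \<in> \<Lambda>"
    and diff: "u \<in> \<Lambda> \<Longrightarrow> v \<in> \<Lambda> \<Longrightarrow> u - v \<in> \<Lambda>"
    and fin: "t0 \<le> t \<Longrightarrow> finite (cube_points \<Lambda> (\<lambda>_. t))"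
    and lower: "t0 \<le> t \<Longrightarrow> t ^ CARD('d) \<le> real (card (cube_points \<Lambda> (\<lambda>_. t)))"
    and upper: "t0 \<le> t \<Longrightarrow> real (card (cube_points \<Lambda> (\<lambda>_. t))) \<le> (3 * t) ^ CARD('d)"
    and eps_pos: "0 < \<epsilon>"
    and no_short: "v \<in> \<Lambda> \<Longrightarrow> (\<And>i. \<bar>v $ i\<bar> < \<epsilon>) \<Longrightarrow> v = 0"
begin

lemma add: "u \<in> \<Lambda> \<Longrightarrow> v \<in> \<Lambda> \<Longrightarrow> u + v \<in> \<Lambda>"
  using diff[of u "0 - v"] diff[OF zero, of v] by simp

lemma scale_nat: "v \<in> \<Lambda> \<Longrightarrow> real k *\<^sub>R v \<in> \<Lambda>"
  by (induction k) (auto simp: zero algebra_simps intro: add)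

lemma scale_int: "v \<in> \<Lambda> \<Longrightarrow> of_int k *\<^sub>R v \<in> \<Lambda>"
  using scale_nat[of v "nat k"] diff[OF zero scale_nat[of v "nat (- k)"]]
  by (cases "0 \<le> k") auto

lemma sum_mem: "finite I \<Longrightarrow> (\<And>i. i \<in> I \<Longrightarrow> f i \<in> \<Lambda>) \<Longrightarrow> sum f I \<in> \<Lambda>"
  by (induction I rule: finite_induct) (auto simp: zero intro: add)

text \<open>Pigeonhole in the spirit of Minkowski's first theorem: if all vectors of size at most the bound
  lay in the hyperplane \<open>u \<bullet> x = 0\<close>, a cell that is thin along the hyperplane and long across it
  would contain two lattice points, whose difference is shorter than \<open>\<epsilon>\<close>.\<close>

lemma span_bounded:
  defines "e \<equiv> \<epsilon> / CARD('d)"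
  shows "span (cube_points \<Lambda> (\<lambda>_. (5 * CARD('d)) ^ CARD('d) / e ^ (CARD('d) - 1) + \<epsilon>)) = UNIV"
proof (rule ccontr)
  define d where "d = real CARD('d)"
  \<comment> \<open>Chosen for the pigeonhole: cells of size \<open>M\<close> in one direction and
    \<open>e\<close> in the others number at most \<open>(4 * d * t) ^ d / (5 * d) ^ d\<close>,
    fewer than the \<open>t ^ d\<close> lattice points.\<close>
  define M where "M = (5 * d) ^ CARD('d) / e ^ (CARD('d) - 1)"
  define V where "V = cube_points \<Lambda> (\<lambda>_. M + \<epsilon>)"
  assume "\<not> ?thesis"
  then have "span V \<noteq> UNIV" by (simp add: V_def M_def d_def)
  then obtain u0 where u0: "u0 \<noteq> 0" "\<And>v. v \<in> span V \<Longrightarrow> u0 \<bullet> v = 0"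
    using orthogonal_to_subspace_exists_gen[of V UNIV]
    by (metis orthogonal_def span_UNIV span_base top.not_eq_extremum UNIV_I psubset_eq subset_UNIV span_mono)
  have d1: "1 \<le> d" unfolding d_def by (simp add: Suc_leI)
  have e0: "0 < e" using eps_pos by (simp add: e_def)
  have M0: "0 < M" using d1 e0 by (simp add: M_def)
  obtain i0 where i0: "\<And>i. \<bar>u0 $ i\<bar> \<le> \<bar>u0 $ i0\<bar>" using ex_argmax[of "\<lambda>i. \<bar>u0 $ i\<bar>"] by blast
  have nz: "u0 $ i0 \<noteq> 0"
  proof
    assume "u0 $ i0 = 0"
    then have "u0 $ i = 0" for i using i0[of i] by simp
    then show False using u0(1) by (simp add: vec_eq_iff)
  qed
  \<comment> \<open>Scaling by the largest coordinate makes \<open>L v\<close> equal to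
    \<open>v $ i0\<close> plus a combination of the other coordinates with coefficients of absolute
    value at most 1. So the value of \<open>L\<close> can replace the coordinate \<open>i0\<close>
    in the labelling of cells.\<close>
  define u where "u = (\<lambda>i. u0 $ i / u0 $ i0)"
  have ui0: "u i0 = 1" using nz by (simp add: u_def)
  have u1: "\<bar>u i\<bar> \<le> 1" for i using i0[of i] nz by (simp add: u_def abs_divide divide_le_eq_1)
  define L where "L v = (\<Sum>i\<in>UNIV. u i * v $ i)" for v :: "real^'d"
  have L_diff: "L (v - w) = L v - L w" for v w
    by (simp add: L_def sum_subtractf algebra_simps)
  have LV: "L v = 0" if "v \<in> V" for v
  proof -
    have "u0 \<bullet> v = 0" using u0(2) that by (simp add: span_base)
    then have "(\<Sum>i\<in>UNIV. u0 $ i * v $ i) / u0 $ i0 = 0" by (simp add: inner_vec_def)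
    then show ?thesis by (simp add: L_def u_def sum_divide_distrib)
  qed
  \<comment> \<open>With \<open>2 * e\<close> and \<open>2 * M\<close> below \<open>t\<close>, every
    range extends at least two cells to either side of 0, so that rounding at most doubles the
    number of cells.\<close>
  define t where "t = Max {t0, 2 * e, 2 * M, 1}"
  have t: "t0 \<le> t" "2 * e \<le> t" "2 * M \<le> t" "1 \<le> t" by (auto simp: t_def)
  define W where "W = cube_points \<Lambda> (\<lambda>_. t)"
  have Lt: "\<bar>L v\<bar> \<le> d * t" if "v \<in> W" for v
  proof -
    have "\<bar>L v\<bar> \<le> (\<Sum>i\<in>UNIV. \<bar>u i * v $ i\<bar>)" unfolding L_def by (rule sum_abs)
    also have "\<dots> \<le> (\<Sum>i\<in>(UNIV::'d set). 1 * t)"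
      using that u1 unfolding abs_mult
      by (intro sum_mono mult_mono) (auto simp: W_def cube_points_def)
    finally show ?thesis by (simp add: d_def)
  qed
  define E where "E = (\<lambda>i. if i = i0 then M else e)"
  define c where "c v = (\<lambda>i. if i = i0 then \<lfloor>L v / E i\<rfloor> else \<lfloor>v $ i / E i\<rfloor>)" for v :: "real^'d"
  define F where "F i = {\<lfloor>- (d * t) / E i\<rfloor> .. \<lfloor>d * t / E i\<rfloor>}" for i :: 'd
  have E0: "0 < E i" "2 * E i \<le> t" for i using e0 M0 t by (auto simp: E_def)
  have "c ` W \<subseteq> PiE UNIV F"
  proof (clarsimp simp: PiE_UNIV_domain)
    fix v i assume v: "v \<in> W"
    have "\<bar>v $ i\<bar> \<le> 1 * t" using v by (simp add: W_def cube_points_def)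
    also have "\<dots> \<le> d * t" using d1 t by (intro mult_right_mono) auto
    finally have 1: "- (d * t) \<le> v $ i" "v $ i \<le> d * t" by auto
    have 2: "- (d * t) \<le> L v" "L v \<le> d * t" using Lt[OF v] by auto
    note le = divide_right_mono[OF _ less_imp_le[OF E0(1)[of i]]]
    show "c v i \<in> F i" unfolding c_def F_def
      using 1[THEN le] 2[THEN le] by (auto intro!: floor_mono)
  qed
  then have "card (c ` W) \<le> card (PiE UNIV F)" by (intro card_mono finite_PiE) (auto simp: F_def)
  also have "card (PiE UNIV F) = (\<Prod>i\<in>UNIV. card (F i))" by (simp add: card_PiE)
  finally have "real (card (c ` W)) \<le> (\<Prod>i\<in>UNIV. real (card (F i)))"
    by (metis of_nat_le_iff of_nat_prod)
  also have "\<dots> \<le> (\<Prod>i\<in>UNIV. 4 * d * t / E i)"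
  proof (intro prod_mono conjI)
    fix i
    define X where "X = d * t / E i"
    have "1 * 2 \<le> d * (t / E i)" using d1 E0[of i] by (intro mult_mono) (auto simp: field_simps)
    then have "2 \<le> X" by (simp add: X_def)
    moreover have "F i = {\<lfloor>- X\<rfloor> .. \<lfloor>X\<rfloor>}" by (simp add: F_def X_def)
    ultimately have "real (card (F i)) \<le> 4 * X" by simp linarith
    then show "real (card (F i)) \<le> 4 * d * t / E i" by (simp add: X_def)
  qed auto
  also have "\<dots> = (4 * d * t) ^ CARD('d) / (\<Prod>i\<in>UNIV. E i)" by (simp add: prod_dividef)
  also have "(\<Prod>i\<in>UNIV. E i) = M * (\<Prod>i\<in>UNIV - {i0}. E i)"
    by (subst prod.remove[of UNIV i0]) (auto simp: E_def)
  also have "(\<Prod>i\<in>UNIV - {i0}. E i) = (\<Prod>i\<in>UNIV - {i0}. e)" by (intro prod.cong) (auto simp: E_def)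
  also have "\<dots> = e ^ (CARD('d) - 1)" by (simp add: card_Diff_singleton)
  also have "(4 * d * t) ^ CARD('d) / (M * e ^ (CARD('d) - 1)) = (4 * d * t) ^ CARD('d) / (5 * d) ^ CARD('d)"
    using e0 by (simp add: M_def)
  also have "\<dots> < (5 * d * t) ^ CARD('d) / (5 * d) ^ CARD('d)"
    using d1 t by (intro divide_strict_right_mono power_strict_mono) auto
  also have "\<dots> = t ^ CARD('d)" using d1 by (simp add: power_mult_distrib)
  also have "\<dots> \<le> real (card W)" using lower[OF t(1)] by (simp add: W_def)
  finally have "\<not> inj_on c W" using card_image by fastforce
  then obtain v w where vw: "v \<in> W" "w \<in> W" "v \<noteq> w" "c v = c w" by (auto simp: inj_on_def)
  have close: "\<bar>a - b\<bar> < s" if "\<lfloor>a / s\<rfloor> = \<lfloor>b / s\<rfloor>" "0 < s" for a b s :: real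
  proof -
    have "\<bar>a / s - b / s\<bar> < 1" using that(1) by linarith
    then have "\<bar>(a - b) / s\<bar> < 1" by (simp add: diff_divide_distrib)
    then show ?thesis using that(2) by (simp add: abs_divide)
  qed
  define z where "z = v - w"
  have zL: "z \<in> \<Lambda>" using vw by (auto simp: z_def W_def cube_points_def intro: diff)
  have z0: "z \<noteq> 0" using vw by (simp add: z_def)
  have zi: "\<bar>z $ i\<bar> < e" if "i \<noteq> i0" for i
  proof -
    have "\<lfloor>v $ i / e\<rfloor> = \<lfloor>w $ i / e\<rfloor>" using fun_cong[OF vw(4), of i] that by (simp add: c_def E_def)
    then show ?thesis using close e0 by (simp add: z_def)
  qed
  have "\<lfloor>L v / M\<rfloor> = \<lfloor>L w / M\<rfloor>" using fun_cong[OF vw(4), of i0] by (simp add: c_def E_def)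
  then have LM: "\<bar>L z\<bar> < M" using close M0 by (simp add: z_def L_diff)
  define X where "X = (\<Sum>i\<in>UNIV - {i0}. u i * z $ i)"
  have Lz: "L z = z $ i0 + X"
    unfolding L_def X_def by (subst sum.remove[of UNIV i0]) (auto simp: ui0)
  have "\<bar>X\<bar> \<le> (\<Sum>i\<in>UNIV - {i0}. \<bar>u i * z $ i\<bar>)" unfolding X_def by (rule sum_abs)
  also have "\<dots> \<le> (\<Sum>i\<in>UNIV - {i0}. 1 * e)"
    using zi u1 unfolding abs_mult by (intro sum_mono mult_mono) (auto intro: less_imp_le)
  also have "\<dots> = d * e - e" by (simp add: d_def card_Diff_singleton of_nat_diff Suc_leI algebra_simps)
  also have "d * e = \<epsilon>" by (simp add: d_def e_def)
  finally have X: "\<bar>X\<bar> < \<epsilon>" using e0 by simp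
  have e_le: "e \<le> \<epsilon>" using d1 eps_pos by (simp add: e_def d_def divide_le_eq)
  \<comment> \<open>So \<open>L\<close> annihilates \<open>z\<close>, which determines the one
    coordinate that the cells leave long: \<open>z $ i0 = - X\<close>, a sum of fewer than
    \<open>d\<close> terms of size at most \<open>e = \<epsilon> / d\<close>.\<close>
  have "z \<in> V" unfolding V_def cube_points_def
  proof (safe)
    fix i show "\<bar>z $ i\<bar> \<le> M + \<epsilon>"
      by (cases "i = i0") (use zi[of i] e_le M0 LM X Lz in auto)
  qed (rule zL)
  then have "z $ i0 = - X" using LV Lz by simp
  then have "\<bar>z $ i\<bar> < \<epsilon>" for i
    using zi[of i] X e_le by (cases "i = i0") auto
  then show False using no_short[OF zL] z0 by blast
qed

text \<open>Coefficients in a basis taken from the short spanning vectors are rounded down; what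
  remains is a sum of at most \<open>d\<close> vectors with coefficients at most 1.\<close>

lemma covering:
  fixes g :: "real^'d"
  shows "\<exists>w\<in>\<Lambda>. \<forall>i. \<bar>g $ i - w $ i\<bar> \<le> covering_radius CARD('d) \<epsilon>"
proof -
  define M where "M = (5 * CARD('d)) ^ CARD('d) / (\<epsilon> / CARD('d)) ^ (CARD('d) - 1) + \<epsilon>"
  have M0: "0 < M" using eps_pos unfolding M_def by (intro add_nonneg_pos divide_nonneg_nonneg) auto
  define V where "V = cube_points \<Lambda> (\<lambda>_. M)"
  obtain B where B: "B \<subseteq> V" "independent B" "V \<subseteq> span B"
    using maximal_independent_subset[of V] by metis
  have "g \<in> span V" using span_bounded by (simp add: V_def M_def)
  then have "g \<in> span B" using B(3) by (metis span_minimal subspace_span subsetD)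
  moreover have finB: "finite B" using B(2) by (rule independent_imp_finite)
  ultimately obtain c where c: "g = (\<Sum>v\<in>B. c v *\<^sub>R v)" by (auto simp: span_finite)
  have cardB: "card B \<le> CARD('d)" using independent_bound[OF B(2)] by simp
  define w where "w = (\<Sum>v\<in>B. of_int \<lfloor>c v\<rfloor> *\<^sub>R v)"
  have "w \<in> \<Lambda>" unfolding w_def
    using finB B(1) by (intro sum_mem scale_int) (auto simp: V_def cube_points_def)
  moreover have "\<bar>g $ i - w $ i\<bar> \<le> covering_radius CARD('d) \<epsilon>" for i
  proof -
    have "g $ i - w $ i = (\<Sum>v\<in>B. (c v - of_int \<lfloor>c v\<rfloor>) * v $ i)"
      by (simp add: c w_def sum_subtractf algebra_simps)
    also have "\<bar>\<dots>\<bar> \<le> (\<Sum>v\<in>B. \<bar>(c v - of_int \<lfloor>c v\<rfloor>) * v $ i\<bar>)" by (rule sum_abs)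
    also have "\<dots> \<le> (\<Sum>v\<in>B. 1 * M)"
    proof (rule sum_mono)
      fix v assume "v \<in> B"
      then have "\<bar>v $ i\<bar> \<le> M" using B(1) by (auto simp: V_def cube_points_def)
      moreover have "\<bar>c v - of_int \<lfloor>c v\<rfloor>\<bar> \<le> 1" by linarith
      ultimately show "\<bar>(c v - of_int \<lfloor>c v\<rfloor>) * v $ i\<bar> \<le> 1 * M"
        unfolding abs_mult by (intro mult_mono) auto
    qed
    also have "\<dots> \<le> CARD('d) * M" using cardB M0 by simp
    finally show ?thesis by (simp add: covering_radius_def M_def)
  qed
  ultimately show ?thesis by blast
qed

text \<open>A large cube is packed with disjoint boxes around grid points; by the covering property each of
  them contains a translate of the counted set, so the density bounds its cardinality.\<close>

lemma card_box:
  assumes S: "\<And>i. covering_radius CARD('d) \<epsilon> \<le> S i"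
  shows "finite (cube_points \<Lambda> S) \<and> real (card (cube_points \<Lambda> S)) \<le> 36 ^ CARD('d) * (\<Prod>i\<in>UNIV. S i)"
proof
  define d where "d = CARD('d)"
  \<comment> \<open>One \<open>S i\<close> for the counted vector, one for the distance from a grid
    point to the lattice. Grid points spaced by \<open>3 * h i\<close> then give disjoint boxes of
    half-side \<open>h i\<close>.\<close>
  define h where "h i = 2 * S i" for i
  have S0: "0 < S i" for i using S[of i] covering_radius_pos[of "CARD('d)" \<epsilon>] eps_pos by simp
  obtain i1 where i1: "\<And>i. h i \<le> h i1" using ex_argmax[of h] by blast
  \<comment> \<open>\<open>6 * h i \<le> t\<close> lets rounding \<open>t / (3 * h i)\<close> down
    cost at most a factor 2. The constant 36 is 3 from the upper density times 12 from
    \<open>6 * h i = 12 * S i\<close>.\<close>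
  define t where "t = max t0 (6 * h i1)"
  have t: "t0 \<le> t" "6 * h i \<le> t" for i using i1[of i] by (auto simp: t_def)
  have h0: "0 < h i" for i using S0[of i] by (simp add: h_def)
  have t0: "0 < t" using h0[of undefined] t(2)[of undefined] by linarith
  define W where "W = cube_points \<Lambda> (\<lambda>_. t)"
  define B where "B = cube_points \<Lambda> S"
  have "B \<subseteq> W"
  proof
    fix v assume v: "v \<in> B"
    have "\<bar>v $ i\<bar> \<le> t" for i
    proof -
      have "\<bar>v $ i\<bar> \<le> S i" using v by (simp add: B_def cube_points_def)
      then show ?thesis using t(2)[of i] S0[of i] by (simp add: h_def)
    qed
    then show "v \<in> W" using v by (simp add: B_def W_def cube_points_def)
  qed
  then show finB: "finite (cube_points \<Lambda> S)" using fin[OF t(1)] finite_subset by (auto simp: B_def W_def)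
  define K where "K i = nat \<lfloor>t / (3 * h i)\<rfloor>" for i
  define Gr where "Gr = PiE UNIV (\<lambda>i. {..<K i})"
  define g where "g k = (\<chi> i. 3 * h i * real (k i))" for k :: "'d \<Rightarrow> nat"
  obtain w where w: "\<And>k. w k \<in> \<Lambda>" "\<And>k i. \<bar>g k $ i - w k $ i\<bar> \<le> covering_radius CARD('d) \<epsilon>"
  proof -
    have "\<exists>w. \<forall>k. w k \<in> \<Lambda> \<and> (\<forall>i. \<bar>g k $ i - w k $ i\<bar> \<le> covering_radius CARD('d) \<epsilon>)"
      using covering by (intro choice) blast
    then show ?thesis using that by blast
  qed
  define \<phi> where "\<phi> = (\<lambda>(k, v). w k + v)"
  have near: "\<bar>\<phi> (k, v) $ i - g k $ i\<bar> \<le> h i" if "v \<in> B" for k v i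
  proof -
    have "\<bar>v $ i\<bar> \<le> S i" using that by (simp add: B_def cube_points_def)
    then show ?thesis using w(2)[of k i] S[of i] by (simp add: \<phi>_def h_def)
  qed
  have "inj_on \<phi> (Gr \<times> B)"
  proof (rule inj_onI, clarify)
    fix k v k' v' assume B: "v \<in> B" "v' \<in> B" and eq: "\<phi> (k, v) = \<phi> (k', v')"
    have "k i = k' i" for i
    proof -
      have "\<bar>g k $ i - g k' $ i\<bar> \<le> 2 * h i" using near[OF B(1), of k i] near[OF B(2), of k' i] eq by simp
      then have "\<bar>3 * h i * (real (k i) - real (k' i))\<bar> \<le> 2 * h i" by (simp add: g_def algebra_simps)
      then have "3 * h i * \<bar>real (k i) - real (k' i)\<bar> \<le> 2 * h i" using h0[of i] by (simp add: abs_mult)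
      then have "h i * (3 * \<bar>real (k i) - real (k' i)\<bar>) \<le> h i * 2" by (simp add: algebra_simps)
      then have "3 * \<bar>real (k i) - real (k' i)\<bar> \<le> 2" using h0[of i] by simp
      then show ?thesis by (cases "k i" "k' i" rule: linorder_cases) (auto simp: nat_less_real_le)
    qed
    then have "k = k'" by auto
    then show "k = k' \<and> v = v'" using eq by (simp add: \<phi>_def)
  qed
  moreover have "\<phi> ` (Gr \<times> B) \<subseteq> W"
  proof (clarify)
    fix k v assume k: "k \<in> Gr" and v: "v \<in> B"
    have "\<phi> (k, v) \<in> \<Lambda>" using w v by (auto simp: \<phi>_def B_def cube_points_def intro: add)
    moreover have "\<bar>\<phi> (k, v) $ i\<bar> \<le> t" for i
    proof -
      have "real (k i) + 1 \<le> real (K i)" using k by (auto simp: Gr_def PiE_UNIV_domain Pi_iff nat_less_real_le)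
      also have "\<dots> \<le> t / (3 * h i)" using t0 h0[of i] by (simp add: K_def)
      finally have "(real (k i) + 1) * (3 * h i) \<le> t" using h0[of i] by (simp add: field_simps)
      then have "g k $ i + 3 * h i \<le> t" by (simp add: g_def algebra_simps)
      moreover have "0 \<le> g k $ i" using h0[of i] by (simp add: g_def)
      ultimately show ?thesis using near[OF v, of k i] h0[of i] t(2)[of i] by linarith
    qed
    ultimately show "\<phi> (k, v) \<in> W" by (simp add: W_def cube_points_def)
  qed
  ultimately have "card (Gr \<times> B) \<le> card W"
    using fin[OF t(1)] by (metis W_def card_inj_on_le)
  then have le: "real (card Gr) * real (card B) \<le> real (card W)"
    by (metis card_cartesian_product of_nat_le_iff of_nat_mult)
  have "(\<Prod>i\<in>UNIV. t / (6 * h i)) \<le> (\<Prod>i\<in>UNIV. real (K i))"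
  proof (intro prod_mono conjI)
    fix i
    have "2 \<le> t / (3 * h i)" using t(2)[of i] h0[of i] by (simp add: field_simps)
    then have "t / (3 * h i) / 2 \<le> real (K i)" unfolding K_def by (intro half_le_nat_floor) simp
    then show "t / (6 * h i) \<le> real (K i)" by simp
    show "0 \<le> t / (6 * h i)" using t0 h0[of i] by simp
  qed
  also have "\<dots> = real (card Gr)" by (simp add: Gr_def card_PiE)
  finally have "(\<Prod>i\<in>UNIV. t / (6 * h i)) * real (card B) \<le> real (card Gr) * real (card B)"
    by (intro mult_right_mono) auto
  also note le
  also have "real (card W) \<le> (3 * t) ^ d" using upper[OF t(1)] by (simp add: W_def d_def)
  finally have *: "(\<Prod>i\<in>UNIV. t / (6 * h i)) * real (card B) \<le> (3 * t) ^ d" .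
  have P: "(\<Prod>i\<in>UNIV. t / (6 * h i)) = t ^ d / (12 ^ d * (\<Prod>i\<in>UNIV. S i))"
    by (simp add: prod_dividef h_def d_def prod.distrib)
  have Sp: "0 < (\<Prod>i\<in>UNIV. S i)" using S0 by (simp add: prod_pos)
  have "t ^ d * real (card B) \<le> (3 * t) ^ d * (12 ^ d * (\<Prod>i\<in>UNIV. S i))"
    using * Sp unfolding P by (simp add: field_simps)
  also have "\<dots> = t ^ d * (36 ^ d * (\<Prod>i\<in>UNIV. S i))"
    by (simp add: power_mult_distrib flip: power_mult_distrib[of 3 12])
  finally show "real (card (cube_points \<Lambda> S)) \<le> 36 ^ CARD('d) * (\<Prod>i\<in>UNIV. S i)"
    using t0 by (simp add: B_def d_def)
qed

end

section \<open>Short vectors at the next scale\<close>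

lemma card_le_spread_nat:
  fixes S :: "nat set"
  assumes "\<And>k l. k \<in> S \<Longrightarrow> l \<in> S \<Longrightarrow> real k - real l \<le> L" and "0 \<le> L"
  shows "real (card S) \<le> L + 1"
proof -
  have "real (card (int ` S)) \<le> L + 1"
    by (rule conjunct2[OF card_le_spread]) (use assms in auto)
  then show ?thesis by (simp add: card_image)
qed

text \<open>Once the digits outside \<open>J\<close> are fixed, each digit in \<open>J\<close> has
  at most \<open>c e\<close> values. These choices are independent because \<open>R\<close> sees
  only the digits outside \<open>J\<close> and the one digit at \<open>e\<close>.\<close>

lemma card_PiE_fibers_le:
  fixes F :: "'e::finite \<Rightarrow> nat set" and c :: "'e \<Rightarrow> real"
  assumes fin: "\<And>e. finite (F e)"
    and R: "\<And>D e. e \<in> J \<Longrightarrow> real (card {k \<in> F e. R e D k}) \<le> c e"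
    and Q: "\<And>D e. D \<in> PiE UNIV F \<Longrightarrow> Q D \<Longrightarrow> e \<in> J \<Longrightarrow> R e (restrict D (- J)) (D e)"
  shows "real (card {D \<in> PiE UNIV F. Q D}) \<le> (\<Prod>e\<in>- J. real (card (F e))) * (\<Prod>e\<in>J. c e)"
proof -
  define T where "T = Sigma (PiE (- J) F) (\<lambda>D. PiE J (\<lambda>e. {k \<in> F e. R e D k}))"
  define f where "f D = (restrict D (- J), restrict D J)" for D :: "'e \<Rightarrow> nat"
  have "f D \<in> T" if "D \<in> PiE UNIV F" "Q D" for D
    using that Q[OF that] by (auto simp: f_def T_def PiE_iff)
  then have sub: "f ` {D \<in> PiE UNIV F. Q D} \<subseteq> T" by auto
  have inj: "inj_on f {D \<in> PiE UNIV F. Q D}"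
  proof (rule inj_onI, rule ext)
    fix D D' e assume "f D = f D'"
    then have "restrict D (- J) e = restrict D' (- J) e" "restrict D J e = restrict D' J e"
      by (auto simp: f_def)
    then show "D e = D' e" by (cases "e \<in> J") auto
  qed
  have fin2: "finite {k \<in> F e. R e D k}" for e D using fin by simp
  have finT: "finite T" unfolding T_def by (intro finite_SigmaI finite_PiE fin fin2) auto
  have "card {D \<in> PiE UNIV F. Q D} \<le> card T" by (rule card_inj_on_le[OF inj sub finT])
  also have "card T = (\<Sum>D\<in>PiE (- J) F. card (PiE J (\<lambda>e. {k \<in> F e. R e D k})))"
    unfolding T_def by (intro card_SigmaI ballI finite_PiE fin fin2) auto
  finally have "real (card {D \<in> PiE UNIV F. Q D}) \<le> (\<Sum>D\<in>PiE (- J) F. real (card (PiE J (\<lambda>e. {k \<in> F e. R e D k}))))"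
    unfolding of_nat_sum[symmetric] of_nat_le_iff .
  also have "\<dots> \<le> (\<Sum>D\<in>PiE (- J) F. \<Prod>e\<in>J. c e)"
  proof (rule sum_mono)
    fix D
    have "real (card (PiE J (\<lambda>e. {k \<in> F e. R e D k}))) = (\<Prod>e\<in>J. real (card {k \<in> F e. R e D k}))"
      by (simp add: card_PiE)
    also have "\<dots> \<le> (\<Prod>e\<in>J. c e)" by (intro prod_mono conjI R) auto
    finally show "real (card (PiE J (\<lambda>e. {k \<in> F e. R e D k}))) \<le> (\<Prod>e\<in>J. c e)" .
  qed
  also have "\<dots> = (\<Prod>e\<in>- J. real (card (F e))) * (\<Prod>e\<in>J. c e)" by (simp add: card_PiE)
  finally show ?thesis .
qed

text \<open>The side \<open>A i / B j\<close> becomes \<open>(A i / a i) / (B j * b j)\<close>, so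
  \<open>a i * b j\<close> is the quotient of old and new side; rounding down keeps the children
  inside the box.\<close>

definition grid :: "('m \<Rightarrow> real) \<Rightarrow> ('n \<Rightarrow> real) \<Rightarrow> 'm \<times> 'n \<Rightarrow> nat" where
  "grid a b = (\<lambda>(i, j). nat \<lfloor>a i * b j\<rfloor>)"

lemma grid_ge:
  assumes "1 \<le> a i" and "1 \<le> b j"
  shows "a i * b j / 2 \<le> real (grid a b (i, j))"
proof -
  have "1 * 1 \<le> a i * b j" using assms by (intro mult_mono) auto
  then show ?thesis using half_le_nat_floor[of "a i * b j"] by (simp add: grid_def)
qed

lemma abs_diff_le_twice:
  fixes u v w d :: real
  shows "\<bar>w + u\<bar> < d \<Longrightarrow> \<bar>w + v\<bar> < d \<Longrightarrow> \<bar>u - v\<bar> \<le> 2 * d"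
  by linarith

text \<open>With all digits outside column \<open>k\<close> fixed, the form in row \<open>i\<close>
  moves in steps \<open>y k / (a i * b k)\<close>, so its inequality leaves at most
  \<open>2 * \<epsilon> * b k / |y k| + 1\<close> digits. One digit per row is confined in this way,
  whence the product over \<open>i\<close>.\<close>

lemma card_digits_hit:
  fixes a :: "'m::finite \<Rightarrow> real" and b :: "'n::finite \<Rightarrow> real"
  assumes a: "\<And>i. 1 \<le> a i" and b: "\<And>j. 1 \<le> b j"
    and y: "y k \<noteq> 0" "\<bar>y k\<bar> \<le> \<epsilon> * b k"
  shows "real (card {D \<in> digits (grid a b). \<forall>i. \<bar>X i + (\<Sum>j\<in>UNIV. real (D (i, j)) / (a i * b j) * y j)\<bar> < \<epsilon> / a i})
    \<le> (\<Prod>e\<in>UNIV. real (grid a b e)) * (\<Prod>i\<in>UNIV. 6 * \<epsilon> / (a i * \<bar>y k\<bar>))"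
proof -
  define J where "J = range (\<lambda>i::'m. (i, k))"
  define g where "g i = 6 * \<epsilon> / (a i * \<bar>y k\<bar>)" for i
  define Y where "Y i D = X i + (\<Sum>j\<in>UNIV - {k}. real (D (i, j)) / (a i * b j) * y j)" for i and D :: "'m \<times> 'n \<Rightarrow> nat"
  define R where "R e D l \<longleftrightarrow> \<bar>Y (fst e) D + real l / (a (fst e) * b k) * y k\<bar> < \<epsilon> / a (fst e)"
    for e :: "'m \<times> 'n" and D l
  define c where "c e = real (grid a b e) * g (fst e)" for e
  have a0: "0 < a i" and b0: "0 < b j" for i j using a[of i] b[of j] by auto
  have "0 < \<epsilon> * b k" using y by linarith
  then have \<epsilon>: "0 < \<epsilon>" using b0[of k] by (simp add: zero_less_mult_iff)
  have g0: "0 \<le> g i" for i using \<epsilon> a0[of i] by (simp add: g_def)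
  have "real (card {D \<in> PiE UNIV (\<lambda>e. {..<grid a b e}). \<forall>i. \<bar>X i + (\<Sum>j\<in>UNIV. real (D (i, j)) / (a i * b j) * y j)\<bar> < \<epsilon> / a i})
    \<le> (\<Prod>e\<in>- J. real (card {..<grid a b e})) * (\<Prod>e\<in>J. c e)"
  proof (rule card_PiE_fibers_le[where R=R])
    fix D :: "'m \<times> 'n \<Rightarrow> nat" and e assume "e \<in> J"
    then obtain i where e: "e = (i, k)" by (auto simp: J_def)
    \<comment> \<open>\<open>|y k| \<le> \<epsilon> * b k\<close> gives \<open>2 \<le> L\<close>, so
      the additional 1 costs a factor 3/2. A factor 2 for the rounding in \<open>grid\<close> and
      the 2 in \<open>L\<close> complete the constant 6.\<close>
    define L where "L = 2 * \<epsilon> * b k / \<bar>y k\<bar>"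
    have L2: "2 \<le> L" using y by (simp add: L_def le_divide_eq)
    have "real (card {l \<in> {..<grid a b e}. R e D l}) \<le> L + 1"
    proof (rule card_le_spread_nat)
      fix l l' assume "l \<in> {l \<in> {..<grid a b e}. R e D l}" "l' \<in> {l \<in> {..<grid a b e}. R e D l}"
      then have "\<bar>Y i D + real l / (a i * b k) * y k\<bar> < \<epsilon> / a i" "\<bar>Y i D + real l' / (a i * b k) * y k\<bar> < \<epsilon> / a i"
        by (auto simp: R_def e)
      then have "\<bar>real l / (a i * b k) * y k - real l' / (a i * b k) * y k\<bar> \<le> 2 * (\<epsilon> / a i)"
        by (rule abs_diff_le_twice)
      also have "real l / (a i * b k) * y k - real l' / (a i * b k) * y k = (real l - real l') * (y k / (a i * b k))"
        by (simp add: algebra_simps diff_divide_distrib)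
      finally have "\<bar>real l - real l'\<bar> * (\<bar>y k\<bar> / (a i * b k)) \<le> 2 * (\<epsilon> / a i)"
        using a0[of i] b0[of k] by (simp add: abs_mult)
      then have "\<bar>real l - real l'\<bar> \<le> L"
        using a0[of i] b0[of k] y(1) by (simp add: L_def field_simps)
      then show "real l - real l' \<le> L" by linarith
    qed (use L2 in auto)
    also have "\<dots> \<le> 3 / 2 * L" using L2 by simp
    also have "\<dots> = (a i * b k / 2) * g i" using a0[of i] y(1) by (simp add: L_def g_def field_simps)
    also have "\<dots> \<le> c e"
      unfolding c_def e fst_conv by (intro mult_right_mono g0 grid_ge a b)
    finally show "real (card {l \<in> {..<grid a b e}. R e D l}) \<le> c e" .
  next
    fix D e
    assume D: "\<forall>i. \<bar>X i + (\<Sum>j\<in>UNIV. real (D (i, j)) / (a i * b j) * y j)\<bar> < \<epsilon> / a i" and "e \<in> J"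
    then obtain i where e: "e = (i, k)" by (auto simp: J_def)
    have "Y i (restrict D (- J)) = Y i D"
      unfolding Y_def by (intro arg_cong2[where f="(+)"] sum.cong refl) (auto simp: J_def)
    moreover have "X i + (\<Sum>j\<in>UNIV. real (D (i, j)) / (a i * b j) * y j) = Y i D + real (D (i, k)) / (a i * b k) * y k"
      unfolding Y_def by (subst sum.remove[of UNIV k]) auto
    ultimately show "R e (restrict D (- J)) (D e)" using D[rule_format, of i] by (simp add: R_def e)
  qed auto
  also have "(\<Prod>e\<in>J. c e) = (\<Prod>e\<in>J. real (grid a b e)) * (\<Prod>i\<in>UNIV. g i)"
    unfolding c_def prod.distrib J_def by (subst (2) prod.reindex) (auto intro: injI)
  also have "(\<Prod>e\<in>- J. real (card {..<grid a b e})) * ((\<Prod>e\<in>J. real (grid a b e)) * (\<Prod>i\<in>UNIV. g i))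
    = (\<Prod>e\<in>UNIV. real (grid a b e)) * (\<Prod>i\<in>UNIV. g i)"
    using prod.union_disjoint[of "- J" J "\<lambda>e. real (grid a b e)"] by (simp add: Compl_partition2)
  finally show ?thesis by (simp add: digits_def g_def)
qed

text \<open>With \<open>A\<^sub>i = \<alpha>\<^sub>i(1 / T)\<close>, \<open>B\<^sub>j = \<beta>\<^sub>j(T)\<close> and \<open>x\<close> the matrix \<open>\<Theta>\<close>, this is the condition at scale \<open>T\<close>.\<close>

definition no_short_vector :: "real \<Rightarrow> ('m::finite \<Rightarrow> real) \<Rightarrow> ('n::finite \<Rightarrow> real) \<Rightarrow> ('m \<times> 'n \<Rightarrow> real) \<Rightarrow> bool" where
  "no_short_vector \<epsilon> A B x \<longleftrightarrow> (\<forall>(q :: 'n \<Rightarrow> int) (p :: 'm \<Rightarrow> int).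
     (\<forall>i. \<bar>(\<Sum>j\<in>UNIV. x (i, j) * real_of_int (q j)) + real_of_int (p i)\<bar> < \<epsilon> * A i) \<and> (\<forall>j. \<bar>real_of_int (q j)\<bar> < \<epsilon> * B j)
     \<longrightarrow> (\<forall>j. q j = 0) \<and> (\<forall>i. p i = 0))"

section \<open>The lattice attached to a matrix at a given scale\<close>

definition lattice_vec :: "('m::finite \<Rightarrow> real) \<Rightarrow> ('n::finite \<Rightarrow> real) \<Rightarrow> ('m \<times> 'n \<Rightarrow> real)
    \<Rightarrow> ('n \<Rightarrow> int) \<times> ('m \<Rightarrow> int) \<Rightarrow> real^('m + 'n)" where
  "lattice_vec A B x = (\<lambda>(q, p). \<chi> s. case s of
     Inl i \<Rightarrow> ((\<Sum>j\<in>UNIV. x (i, j) * real_of_int (q j)) + real_of_int (p i)) / A i | Inr j \<Rightarrow> real_of_int (q j) / B j)"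

lemma UNIV_sum_prod:
  fixes f :: "'m::finite + 'n::finite \<Rightarrow> real"
  shows "(\<Prod>s\<in>UNIV. f s) = (\<Prod>i\<in>UNIV. f (Inl i)) * (\<Prod>j\<in>UNIV. f (Inr j))"
  unfolding UNIV_sum by (subst prod.union_disjoint) (auto simp: prod.reindex)

lemma all_sum_iff: "(\<forall>s. P s) \<longleftrightarrow> (\<forall>i. P (Inl i)) \<and> (\<forall>j. P (Inr j))"
  by (metis sum.exhaust)

lemma inj_lattice_vec:
  assumes "\<And>i. 0 < A i" and "\<And>j. 0 < B j"
  shows "inj (lattice_vec A B x)"
proof (rule injI, clarify)
  fix q p q' p' assume eq: "lattice_vec A B x (q, p) = lattice_vec A B x (q', p')"
  have "q j = q' j" for j
    using arg_cong[OF eq, of "\<lambda>v. v $ Inr j"] assms(2)[of j] by (simp add: lattice_vec_def)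
  then have q: "q = q'" by auto
  have "p i = p' i" for i
    using arg_cong[OF eq, of "\<lambda>v. v $ Inl i"] assms(1)[of i] by (simp add: lattice_vec_def q)
  then show "q = q' \<and> p = p'" using q by auto
qed

lemma cube_points_lattice_vec:
  assumes A: "\<And>i. 0 < A i" and B: "\<And>j. 0 < B j"
  shows "cube_points (range (lattice_vec A B x)) S = lattice_vec A B x `
    {(q, p). (\<forall>i. \<bar>(\<Sum>j\<in>UNIV. x (i, j) * real_of_int (q j)) + real_of_int (p i)\<bar> \<le> S (Inl i) * A i) \<and> (\<forall>j. \<bar>real_of_int (q j)\<bar> \<le> S (Inr j) * B j)}"
proof -
  have "(\<forall>s. \<bar>lattice_vec A B x (q, p) $ s\<bar> \<le> S s) \<longleftrightarrow>
    (\<forall>i. \<bar>(\<Sum>j\<in>UNIV. x (i, j) * real_of_int (q j)) + real_of_int (p i)\<bar> \<le> S (Inl i) * A i) \<and> (\<forall>j. \<bar>real_of_int (q j)\<bar> \<le> S (Inr j) * B j)" for q p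
    using A B unfolding all_sum_iff
    by (simp add: lattice_vec_def abs_divide pos_divide_le_eq abs_of_pos)
  then show ?thesis unfolding cube_points_def by (auto simp del: split_paired_All) blast+
qed

text \<open>The vectors in a cube are counted by \<open>q\<close> first, then \<open>p\<close>. Each
  entry runs over the integers in an interval of half-length \<open>h \<ge> 1\<close>, between
  \<open>h\<close> and \<open>3 * h\<close> many wherever its centre lies, so the dependence of
  \<open>p\<close> on \<open>q\<close> does no harm. The half-lengths multiply to
  \<open>t ^ (m + n)\<close> because the covolume is 1; this is the origin of the two density
  bounds.\<close>

lemma unimodular_lattice_vec:
  fixes A :: "'m::finite \<Rightarrow> real" and B :: "'n::finite \<Rightarrow> real"
  assumes A: "\<And>i. 0 < A i" and B: "\<And>j. 0 < B j"
    and covol: "(\<Prod>i\<in>UNIV. A i) * (\<Prod>j\<in>UNIV. B j) = 1"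
    and \<epsilon>: "0 < \<epsilon>" and no_short: "no_short_vector \<epsilon> A B x"
  shows "\<exists>t0. unimodular_lattice (range (lattice_vec A B x)) \<epsilon> t0"
proof -
  \<comment> \<open>Dominates every \<open>1 / A i\<close> and \<open>1 / B j\<close>, so that all
    half-lengths \<open>t * A i\<close> and \<open>t * B j\<close> are at least 1.\<close>
  define t0 where "t0 = (\<Sum>i\<in>UNIV. 1 / A i) + (\<Sum>j\<in>UNIV. 1 / B j)"
  have tA: "1 \<le> t * A i" if "t0 \<le> t" for t i
  proof -
    have "1 / A i \<le> (\<Sum>i\<in>UNIV. 1 / A i)" using A by (intro member_le_sum) (auto simp: less_imp_le)
    also have "\<dots> \<le> t0" using B by (simp add: t0_def sum_nonneg less_imp_le)
    finally show ?thesis using that A[of i] by (simp add: divide_le_eq) (meson mult_right_mono less_imp_le order_trans)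
  qed
  have tB: "1 \<le> t * B j" if "t0 \<le> t" for t j
  proof -
    have "1 / B j \<le> (\<Sum>j\<in>UNIV. 1 / B j)" using B by (intro member_le_sum) (auto simp: less_imp_le)
    also have "\<dots> \<le> t0" using A by (simp add: t0_def sum_nonneg less_imp_le)
    finally show ?thesis using that B[of j] by (simp add: divide_le_eq) (meson mult_right_mono less_imp_le order_trans)
  qed
  have dens: "finite (cube_points (range (lattice_vec A B x)) (\<lambda>_. t))
    \<and> t ^ CARD('m + 'n) \<le> real (card (cube_points (range (lattice_vec A B x)) (\<lambda>_. t)))
    \<and> real (card (cube_points (range (lattice_vec A B x)) (\<lambda>_. t))) \<le> (3 * t) ^ CARD('m + 'n)" if t: "t0 \<le> t" for t
  proof -
    define l where "l i q = (\<Sum>j\<in>UNIV. x (i, j) * real_of_int (q j))" for i and q :: "'n \<Rightarrow> int"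
    define Fq where "Fq j = {k::int. \<bar>0 + k\<bar> \<le> t * B j}" for j
    define Fp where "Fp q i = {k::int. \<bar>l i q + k\<bar> \<le> t * A i}" for q i
    define Z where "Z = Sigma (PiE UNIV Fq) (\<lambda>q. PiE UNIV (Fp q))"
    have Fq: "finite (Fq j)" "t * B j \<le> real (card (Fq j))" "real (card (Fq j)) \<le> 3 * (t * B j)" for j
      unfolding Fq_def using card_int_interval[OF tB[OF t], of 0 j] by auto
    have Fp: "finite (Fp q i)" "t * A i \<le> real (card (Fp q i))" "real (card (Fp q i)) \<le> 3 * (t * A i)" for q i
      unfolding Fp_def using card_int_interval[OF tA[OF t], of "l i q" i] by auto
    have eq: "cube_points (range (lattice_vec A B x)) (\<lambda>_. t) = lattice_vec A B x ` Z"
      unfolding cube_points_lattice_vec[OF A B]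
      by (rule arg_cong[where f="image _"]) (auto simp: Z_def Fq_def Fp_def l_def PiE_iff)
    have card_eq: "card (lattice_vec A B x ` Z) = card Z"
      by (intro card_image inj_on_subset[OF inj_lattice_vec[OF A B]]) auto
    have finZ: "finite Z" unfolding Z_def by (intro finite_SigmaI finite_PiE Fq Fp) auto
    have cZ: "real (card Z) = (\<Sum>q\<in>PiE UNIV Fq. \<Prod>i\<in>UNIV. real (card (Fp q i)))"
      unfolding Z_def using Fq Fp by (subst card_SigmaI) (auto intro!: finite_PiE simp: card_PiE)
    have prod_sum: "(\<Sum>q\<in>PiE UNIV Fq. \<Prod>i\<in>UNIV. s * A i) = (\<Prod>j\<in>UNIV. real (card (Fq j))) * (s ^ CARD('m) * (\<Prod>i\<in>UNIV. A i))" for s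
      by (simp add: card_PiE prod.distrib)
    have AB: "(\<Prod>j\<in>UNIV. s * B j) * (s ^ CARD('m) * (\<Prod>i\<in>UNIV. A i)) = s ^ CARD('m + 'n)" for s
    proof -
      have "(\<Prod>j\<in>UNIV. s * B j) * (s ^ CARD('m) * (\<Prod>i\<in>UNIV. A i))
        = s ^ CARD('m) * s ^ CARD('n) * ((\<Prod>i\<in>UNIV. A i) * (\<Prod>j\<in>UNIV. B j))"
        by (simp add: prod.distrib algebra_simps)
      then show ?thesis by (simp add: covol power_add)
    qed
    have s0: "0 \<le> s * B j" "0 \<le> s * A i" if "s = t \<or> s = 3 * t" for s i j
      using tB[OF t, of j] tA[OF t, of i] that by auto
    have "0 \<le> t" using s0(2)[of t undefined] A[of undefined] by (simp add: zero_le_mult_iff)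
    then have pA: "0 \<le> s ^ CARD('m) * (\<Prod>i\<in>UNIV. A i)" if "s = t \<or> s = 3 * t" for s
      using that A by (auto intro!: mult_nonneg_nonneg prod_nonneg simp: less_imp_le)
    have "t ^ CARD('m + 'n) \<le> (\<Prod>j\<in>UNIV. real (card (Fq j))) * (t ^ CARD('m) * (\<Prod>i\<in>UNIV. A i))"
      unfolding AB[symmetric] using Fq s0 pA by (intro mult_right_mono prod_mono) auto
    also have "\<dots> \<le> real (card Z)"
      unfolding cZ prod_sum[symmetric] using Fp s0 by (intro sum_mono prod_mono) auto
    finally have lo: "t ^ CARD('m + 'n) \<le> real (card Z)" .
    have "real (card Z) \<le> (\<Prod>j\<in>UNIV. real (card (Fq j))) * ((3 * t) ^ CARD('m) * (\<Prod>i\<in>UNIV. A i))"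
      unfolding cZ prod_sum[symmetric] using Fp s0 by (intro sum_mono prod_mono) (auto simp: mult.assoc)
    also have "\<dots> \<le> (3 * t) ^ CARD('m + 'n)"
      unfolding AB[symmetric] using Fq s0 pA by (intro mult_right_mono prod_mono) (auto simp: mult.assoc)
    finally show ?thesis using lo finZ unfolding eq card_eq by auto
  qed
  have "unimodular_lattice (range (lattice_vec A B x)) \<epsilon> t0"
  proof
    have "lattice_vec A B x (\<lambda>_. 0, \<lambda>_. 0) = 0"
      by (simp add: lattice_vec_def vec_eq_iff split: sum.split)
    then show "0 \<in> range (lattice_vec A B x)" by (metis rangeI)
  next
    fix u v assume "u \<in> range (lattice_vec A B x)" "v \<in> range (lattice_vec A B x)"
    then obtain q p q' p' where uv: "u = lattice_vec A B x (q, p)" "v = lattice_vec A B x (q', p')" by auto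
    have "u - v = lattice_vec A B x (\<lambda>j. q j - q' j, \<lambda>i. p i - p' i)"
      unfolding uv
      by (simp add: lattice_vec_def vec_eq_iff diff_divide_distrib algebra_simps sum_subtractf add_divide_distrib split: sum.split)
    then show "u - v \<in> range (lattice_vec A B x)" by auto
  next
    fix v assume "v \<in> range (lattice_vec A B x)" and short: "\<And>s. \<bar>v $ s\<bar> < \<epsilon>"
    then obtain q p where v: "v = lattice_vec A B x (q, p)" by auto
    have 1: "\<bar>(\<Sum>j\<in>UNIV. x (i, j) * real_of_int (q j)) + real_of_int (p i)\<bar> < \<epsilon> * A i" for i
      using short[of "Inl i"] A[of i] by (simp add: v lattice_vec_def abs_divide pos_divide_less_eq)
    have 2: "\<bar>real_of_int (q j)\<bar> < \<epsilon> * B j" for j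
      using short[of "Inr j"] B[of j] by (simp add: v lattice_vec_def abs_divide pos_divide_less_eq)
    have "(\<forall>j. q j = 0) \<and> (\<forall>i. p i = 0)" using no_short 1 2 unfolding no_short_vector_def by blast
    then show "v = 0" by (simp add: v lattice_vec_def vec_eq_iff split: sum.split)
  qed (use dens \<epsilon> in auto)
  then show ?thesis ..
qed

section \<open>Dyadic shells and the proportion of failing children\<close>

lemma power_bracket:
  fixes x R :: real
  assumes "1 < R" "1 \<le> x"
  shows "\<exists>h. R ^ h \<le> x \<and> x < R ^ Suc h"
proof -
  define g where "g = (LEAST h. x < R ^ h)"
  have g: "x < R ^ g" unfolding g_def using real_arch_pow[OF assms(1), of x] by (rule LeastI_ex)
  then have "g \<noteq> 0" using assms(2) by (cases g) auto
  then obtain h where h: "g = Suc h" by (cases g) auto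
  then have "\<not> x < R ^ h" using not_less_Least[of h "\<lambda>h. x < R ^ h"] by (simp add: g_def)
  then show ?thesis using g h by (intro exI[of _ h]) auto
qed

lemma powers_of_two_le:
  fixes x :: real
  assumes "1 \<le> x"
  shows "finite {h. 2 ^ h \<le> x}" and "(\<Sum>h | 2 ^ h \<le> x. 2 ^ h) \<le> 2 * x"
proof -
  let ?H = "{h. 2 ^ h \<le> x}"
  have "h \<le> nat \<lceil>x\<rceil>" if "2 ^ h \<le> x" for h
  proof -
    have "real h < 2 ^ h" by (rule of_nat_less_two_power)
    then show ?thesis using that by linarith
  qed
  then have sub: "?H \<subseteq> {..nat \<lceil>x\<rceil>}" by auto
  then show fin: "finite ?H" by (rule finite_subset) simp
  have "0 \<in> ?H" using assms by simp
  then have ne: "?H \<noteq> {}" by blast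
  define g where "g = Max ?H"
  have g: "2 ^ g \<le> x" using Max_in[OF fin ne] by (simp add: g_def)
  have "(\<Sum>h\<in>?H. 2 ^ h :: real) \<le> (\<Sum>h\<le>g. 2 ^ h)"
    using fin by (intro sum_mono2) (auto simp: g_def)
  also have "\<dots> = 2 ^ Suc g - 1" by (induction g) auto
  also have "\<dots> \<le> 2 * x" using g by simp
  finally show "(\<Sum>h\<in>?H. 2 ^ h) \<le> 2 * x" .
qed

text \<open>One factor is bounded by \<open>c\<close>, the others by \<open>b j\<close>. Taken at
  the largest \<open>b k\<close>, this bounds the share of shell \<open>h\<close> by a multiple of
  \<open>2 ^ h / b k\<close>, which is geometric in \<open>h\<close> and so has a bounded sum over
  the shells up to order \<open>b k\<close>.\<close>

lemma prod_min_le: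
  fixes b :: "'n::finite \<Rightarrow> real"
  assumes b: "\<And>j. 0 < b j" and c: "0 \<le> c"
  shows "(\<Prod>j\<in>UNIV. min c (b j)) \<le> c * (\<Prod>j\<in>UNIV. b j) / b k"
proof -
  have "(\<Prod>j\<in>UNIV. min c (b j)) = min c (b k) * (\<Prod>j\<in>UNIV - {k}. min c (b j))"
    by (rule prod.remove) auto
  also have "\<dots> \<le> c * (\<Prod>j\<in>UNIV - {k}. b j)"
    using b c by (intro mult_mono prod_mono prod_nonneg) (auto simp: less_imp_le)
  also have "(\<Prod>j\<in>UNIV - {k}. b j) = (\<Prod>j\<in>UNIV. b j) / b k"
    using b[of k] by (subst prod.remove[of UNIV k]) auto
  finally show ?thesis by simp
qed

text \<open>\<open>36 ^ (m + n)\<close> is the constant of the lattice point count,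
  \<open>(24 * n) ^ m\<close> joins \<open>2 ^ m\<close> from the box sides with
  \<open>(12 * n) ^ m\<close> from the hitting proportion, and \<open>4 * n\<close> bounds the sum
  of the \<open>2 ^ h \<le> 2 * n * b\<close> divided by \<open>b\<close>.\<close>

definition failure_bound :: "nat \<Rightarrow> nat \<Rightarrow> real" where
  "failure_bound m n = (24 * real n) ^ m * 36 ^ (m + n) * (4 * real n)"

text \<open>A lattice vector \<open>(X, y)\<close> becomes short only for the children on which \<open>X + \<Psi> y\<close> is small, a
  proportion of order \<open>(\<epsilon> / \<bar>y\<bar>)^m / R\<close>. Summing over dyadic shells of \<open>\<bar>y\<bar>\<close>, the large shells contribute
  \<open>O(\<epsilon>^(m + n))\<close> with a constant that does not depend on \<open>\<epsilon>\<close>, and the small ones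
  contribute \<open>O(1 / R)\<close>.\<close>

lemma half_of_children:
  fixes \<epsilon> :: real
  defines "m \<equiv> CARD('m::finite)" and "n \<equiv> CARD('n::finite)"
  assumes \<epsilon>: "0 < \<epsilon>" and small: "failure_bound m n * \<epsilon> ^ (m + n) \<le> 1 / 4"
  shows "\<exists>L\<ge>2. \<forall>(A :: 'm \<Rightarrow> real) (B :: 'n \<Rightarrow> real) a b x.
    (\<forall>i. 0 < A i) \<and> (\<forall>j. 0 < B j) \<and> (\<Prod>i\<in>UNIV. A i) * (\<Prod>j\<in>UNIV. B j) = 1 \<and>
    (\<forall>i. L \<le> a i) \<and> (\<forall>j. L \<le> b j) \<and> (\<Prod>i\<in>UNIV. a i) = (\<Prod>j\<in>UNIV. b j) \<and> L \<le> (\<Prod>j\<in>UNIV. b j) \<and>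
    no_short_vector \<epsilon> A B x \<longrightarrow>
    (\<Prod>e\<in>UNIV. real (grid a b e)) / 2 \<le> real (card {D \<in> digits (grid a b).
      no_short_vector \<epsilon> (\<lambda>i. A i / a i) (\<lambda>j. B j * b j) (child x (\<lambda>(i, j). (A i / a i) / (B j * b j)) D)})"
proof -
  define d where "d = m + n"
  define \<rho> where "\<rho> = covering_radius d \<epsilon>"
  have n0: "0 < real n" by (simp add: n_def)
  have n1: "1 \<le> real n" by (simp add: n_def Suc_le_eq)
  \<comment> \<open>From shell \<open>h0\<close> on, the side \<open>2 ^ h * \<epsilon> / n\<close>
    exceeds the covering radius and the point count applies. The lower shells lie in
    \<open>S h0\<close> and are counted crudely by \<open>C0\<close>.\<close>
  obtain h0 :: nat where h0: "\<rho> * n / \<epsilon> < 2 ^ h0" using real_arch_pow[of 2] by auto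
  define C0 where "C0 = 36 ^ d * (2 ^ Suc h0 * \<epsilon>) ^ m * (2 ^ h0 * \<epsilon>) ^ n"
  have C0: "0 \<le> C0" using \<epsilon> by (simp add: C0_def)
  \<comment> \<open>The second entry puts the sides \<open>\<epsilon> * b j\<close> above the
    covering radius; the third makes the \<open>h0\<close> lower shells contribute at most 1/4 after
    division by \<open>R\<close>.\<close>
  define L where "L = Max {2, \<rho> / \<epsilon>, 4 * (real h0 * (C0 * (12 * real n) ^ m))}"
  have L: "2 \<le> L" "\<rho> / \<epsilon> \<le> L" "4 * (real h0 * (C0 * (12 * real n) ^ m)) \<le> L" by (auto simp: L_def)
  show ?thesis
  proof (intro exI[of _ L] conjI L(1) allI impI, elim conjE)
    fix A a :: "'m \<Rightarrow> real" and B b :: "'n \<Rightarrow> real" and x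
    assume "\<forall>i. 0 < A i" "\<forall>j. 0 < B j" and covol: "(\<Prod>i\<in>UNIV. A i) * (\<Prod>j\<in>UNIV. B j) = 1"
      and "\<forall>i. L \<le> a i" "\<forall>j. L \<le> b j" and ab: "(\<Prod>i\<in>UNIV. a i) = (\<Prod>j\<in>UNIV. b j)"
      and LR: "L \<le> (\<Prod>j\<in>UNIV. b j)" and no_short: "no_short_vector \<epsilon> A B x"
    then have A: "0 < A i" and B: "0 < B j" and aL: "L \<le> a i" and bL: "L \<le> b j" for i j by auto
    have a2: "2 \<le> a i" and b2: "2 \<le> b j" and a0: "0 < a i" and b0: "0 < b j" for i j
      using aL[of i] bL[of j] L(1) by auto
    define R where "R = (\<Prod>j\<in>UNIV. b j)"
    have R0: "0 < R" using LR L(1) by (simp add: R_def)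
    obtain jm where jm: "\<And>j. b j \<le> b jm" using ex_argmax[of b] by blast
    define N where "N = grid a b"
    define P where "P = (\<Prod>e\<in>UNIV. real (N e))"
    have P0: "0 \<le> P" by (simp add: P_def prod_nonneg)
    define lin where "lin i q = (\<Sum>j\<in>UNIV. x (i, j) * real_of_int (q j))" for i and q :: "'n \<Rightarrow> int"
    define X where "X z i = (lin i (fst z) + real_of_int (snd z i)) / A i" for z :: "('n \<Rightarrow> int) \<times> ('m \<Rightarrow> int)" and i
    define y where "y z j = real_of_int (fst z j) / B j" for z :: "('n \<Rightarrow> int) \<times> ('m \<Rightarrow> int)" and j
    define side where "side h = (\<lambda>s::'m + 'n. case s of Inl _ \<Rightarrow> 2 ^ Suc h * \<epsilon> | Inr j \<Rightarrow> min (2 ^ h * \<epsilon> / n) (\<epsilon> * b j))" for h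
    \<comment> \<open>The bound \<open>\<epsilon> * b j\<close> enters because only vectors with
      \<open>|y z j| < \<epsilon> * b j\<close> can be short at the next scale; it caps the count in
      directions where \<open>b j\<close> is small.\<close>
    define S where "S h = {z. (\<forall>i. \<bar>X z i\<bar> \<le> 2 ^ Suc h * \<epsilon>) \<and> (\<forall>j. \<bar>y z j\<bar> \<le> min (2 ^ h * \<epsilon> / n) (\<epsilon> * b j))}" for h
    have S_eq: "cube_points (range (lattice_vec A B x)) (side h) = lattice_vec A B x ` S h" for h
      unfolding cube_points_lattice_vec[OF A B] S_def
      by (rule arg_cong[where f="image _"])
        (use A B in \<open>auto simp: side_def X_def y_def lin_def abs_divide pos_divide_le_eq abs_of_pos simp del: min_less_iff_conj min.bounded_iff\<close>)
    have S_card: "finite (S h) \<and> real (card (S h)) \<le> 36 ^ d * (\<Prod>s\<in>UNIV. side h s)" if h: "h0 \<le> h" for h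
    proof -
      obtain t0 where "unimodular_lattice (range (lattice_vec A B x)) \<epsilon> t0"
        using unimodular_lattice_vec[OF A B covol \<epsilon> no_short] by blast
      then interpret unimodular_lattice "range (lattice_vec A B x)" \<epsilon> t0 .
      have "(2::real) ^ h0 \<le> 2 ^ h" using h by simp
      then have "\<rho> * n / \<epsilon> \<le> 2 ^ h" using h0 by linarith
      then have \<rho>h: "\<rho> \<le> 2 ^ h * \<epsilon> / n" using \<epsilon> n0 by (simp add: field_simps)
      also have "\<dots> \<le> 2 ^ h * \<epsilon> / 1" using \<epsilon> n1 by (intro divide_left_mono) auto
      also have "\<dots> \<le> 2 ^ Suc h * \<epsilon>" using \<epsilon> by simp
      finally have \<rho>h2: "\<rho> \<le> 2 ^ Suc h * \<epsilon>" .
      have "\<rho> / \<epsilon> \<le> b j" for j using L(2) bL[of j] by linarith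
      then have "\<rho> \<le> \<epsilon> * b j" for j using \<epsilon> by (simp add: field_simps)
      then have "covering_radius CARD('m + 'n) \<epsilon> \<le> side h s" for s
        using \<rho>h \<rho>h2 by (auto simp: \<rho>_def d_def m_def n_def side_def split: sum.split)
      note box = card_box[of "side h", OF this]
      have inj: "inj_on (lattice_vec A B x) (S h)"
        by (rule inj_on_subset[OF inj_lattice_vec[OF A B]]) simp
      from box show ?thesis
        unfolding S_eq by (simp add: card_image[OF inj] finite_image_iff[OF inj] d_def m_def n_def)
    qed
    have prod_side: "(\<Prod>s\<in>UNIV. side h s) = (2 ^ Suc h * \<epsilon>) ^ m * (\<Prod>j\<in>UNIV. min (2 ^ h * \<epsilon> / n) (\<epsilon> * b j))" for h
      by (simp add: UNIV_sum_prod side_def m_def)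
    have S_mono: "S h \<subseteq> S h'" if "h \<le> h'" for h h'
    proof -
      have p: "(2::real) ^ h \<le> 2 ^ h'" using that by simp
      then have X: "2 ^ Suc h * \<epsilon> \<le> 2 ^ Suc h' * \<epsilon>" and "2 ^ h * \<epsilon> / n \<le> 2 ^ h' * \<epsilon> / n"
        using \<epsilon> n0 by (auto intro!: mult_right_mono divide_right_mono)
      then have Y: "min (2 ^ h * \<epsilon> / n) (\<epsilon> * b j) \<le> min (2 ^ h' * \<epsilon> / n) (\<epsilon> * b j)" for j
        by (intro min.mono) auto
      show ?thesis
      proof
        fix z assume "z \<in> S h"
        then have "\<bar>X z i\<bar> \<le> 2 ^ Suc h * \<epsilon>" "\<bar>y z j\<bar> \<le> min (2 ^ h * \<epsilon> / n) (\<epsilon> * b j)" for i j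
          unfolding S_def by blast+
        from order_trans[OF this(1) X] order_trans[OF this(2) Y] show "z \<in> S h'"
          unfolding S_def by blast
      qed
    qed
    have S_fin: "finite (S h)" for h
      using S_card[of "max h h0"] S_mono[of h "max h h0"] by (auto intro: finite_subset)
    have S_small: "real (card (S h)) \<le> C0" if "h \<le> h0" for h
    proof -
      have "real (card (S h)) \<le> real (card (S h0))" using S_mono[OF that] S_fin by (simp add: card_mono)
      also have "\<dots> \<le> 36 ^ d * ((2 ^ Suc h0 * \<epsilon>) ^ m * (\<Prod>j\<in>UNIV. min (2 ^ h0 * \<epsilon> / n) (\<epsilon> * b j)))"
        using S_card[of h0] by (simp add: prod_side)
      also have "\<dots> \<le> 36 ^ d * ((2 ^ Suc h0 * \<epsilon>) ^ m * (\<Prod>j\<in>(UNIV :: 'n set). 2 ^ h0 * \<epsilon>))"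
      proof (intro mult_left_mono prod_mono conjI)
        fix j
        show "0 \<le> min (2 ^ h0 * \<epsilon> / n) (\<epsilon> * b j)" using \<epsilon> b0[of j] by simp
        have "2 ^ h0 * \<epsilon> / n \<le> 2 ^ h0 * \<epsilon> / 1" using \<epsilon> n1 by (intro divide_left_mono) auto
        then show "min (2 ^ h0 * \<epsilon> / n) (\<epsilon> * b j) \<le> 2 ^ h0 * \<epsilon>" by simp
      qed (use \<epsilon> in auto)
      also have "\<dots> = C0" by (simp add: C0_def n_def)
      finally show ?thesis .
    qed
    have S_large: "real (card (S h)) \<le> 36 ^ d * 2 ^ m * \<epsilon> ^ d * (2 ^ h) ^ m * (2 ^ h * R / b jm)" if "h0 \<le> h" for h
    proof -
      have "(\<Prod>j\<in>UNIV. min (2 ^ h * \<epsilon> / n) (\<epsilon> * b j)) \<le> (\<Prod>j\<in>UNIV. \<epsilon> * min (2 ^ h) (b j))"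
      proof (intro prod_mono conjI)
        fix j
        show "0 \<le> min (2 ^ h * \<epsilon> / n) (\<epsilon> * b j)" using \<epsilon> b0[of j] by simp
        have "2 ^ h * \<epsilon> / n \<le> 2 ^ h * \<epsilon> / 1" using \<epsilon> n1 by (intro divide_left_mono) auto
        then have "min (2 ^ h * \<epsilon> / n) (\<epsilon> * b j) \<le> min (\<epsilon> * 2 ^ h) (\<epsilon> * b j)"
          by (intro min.mono) (auto simp: mult.commute)
        then show "min (2 ^ h * \<epsilon> / n) (\<epsilon> * b j) \<le> \<epsilon> * min (2 ^ h) (b j)"
          using \<epsilon> by (simp add: min_mult_distrib_left)
      qed
      also have "\<dots> = \<epsilon> ^ n * (\<Prod>j\<in>UNIV. min (2 ^ h) (b j))" by (simp add: prod.distrib n_def)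
      also have "\<dots> \<le> \<epsilon> ^ n * (2 ^ h * R / b jm)"
        unfolding R_def using \<epsilon> b0 by (intro mult_left_mono prod_min_le) auto
      finally have "36 ^ d * ((2 ^ Suc h * \<epsilon>) ^ m * (\<Prod>j\<in>UNIV. min (2 ^ h * \<epsilon> / n) (\<epsilon> * b j)))
          \<le> 36 ^ d * ((2 ^ Suc h * \<epsilon>) ^ m * (\<epsilon> ^ n * (2 ^ h * R / b jm)))"
        using \<epsilon> by (intro mult_left_mono) auto
      then show ?thesis
        using S_card[OF that] by (simp add: prod_side power_mult_distrib power_add d_def algebra_simps)
    qed
    \<comment> \<open>The lower bound on one coordinate makes \<open>card_digits_hit\<close>
      effective; the larger set \<open>S h\<close>, a full box of lattice vectors, is the one that
      can be counted.\<close>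
    define T where "T h = {z \<in> S h. \<exists>k. 2 ^ h * \<epsilon> / (2 * n) \<le> \<bar>y z k\<bar> \<and> \<bar>y z k\<bar> \<le> \<epsilon> * b k}" for h
    define hit where "hit z = {D \<in> digits N. \<forall>i. \<bar>X z i + (\<Sum>j\<in>UNIV. real (D (i, j)) / (a i * b j) * y z j)\<bar> < \<epsilon> / a i}" for z
    have hit_card: "real (card (hit z)) \<le> P * ((12 * n) ^ m / ((2 ^ h) ^ m * R))" if "z \<in> T h" for z h
    proof -
      obtain k where k: "2 ^ h * \<epsilon> / (2 * n) \<le> \<bar>y z k\<bar>" "\<bar>y z k\<bar> \<le> \<epsilon> * b k"
        using \<open>z \<in> T h\<close> by (auto simp: T_def)
      have lo: "0 < 2 ^ h * \<epsilon> / (2 * n)" using \<epsilon> n0 by simp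
      then have yk: "0 < \<bar>y z k\<bar>" using k(1) by linarith
      have a1: "1 \<le> a i" and b1: "1 \<le> b j" for i j using a2[of i] b2[of j] by auto
      have "real (card (hit z)) \<le> P * (\<Prod>i\<in>UNIV. 6 * \<epsilon> / (a i * \<bar>y z k\<bar>))"
        unfolding hit_def P_def N_def using yk k(2) by (intro card_digits_hit a1 b1) auto
      also have "\<dots> \<le> P * (\<Prod>i\<in>UNIV. 12 * n / 2 ^ h / a i)"
      proof (intro mult_left_mono P0 prod_mono conjI)
        fix i
        show "0 \<le> 6 * \<epsilon> / (a i * \<bar>y z k\<bar>)" using \<epsilon> a0[of i] by simp
        have "6 * \<epsilon> / (a i * \<bar>y z k\<bar>) \<le> 6 * \<epsilon> / (a i * (2 ^ h * \<epsilon> / (2 * n)))"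
          using \<epsilon> a0[of i] k(1) lo yk by (intro divide_left_mono mult_left_mono mult_pos_pos) auto
        also have "\<dots> = 12 * n / 2 ^ h / a i" using \<epsilon> n0 a0[of i] by (simp add: field_simps)
        finally show "6 * \<epsilon> / (a i * \<bar>y z k\<bar>) \<le> 12 * n / 2 ^ h / a i" .
      qed
      also have "(\<Prod>i\<in>UNIV. 12 * n / 2 ^ h / a i) = (12 * n) ^ m / ((2 ^ h) ^ m * R)"
        by (simp add: prod_dividef prod.distrib ab R_def m_def power_divide)
      finally show ?thesis .
    qed
    define A' where "A' i = A i / a i" for i
    define B' where "B' j = B j * b j" for j
    define w where "w = (\<lambda>(i, j). A' i / B' j)"
    define Bad where "Bad = {D \<in> digits N. \<not> no_short_vector \<epsilon> A' B' (child x w D)}"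
    \<comment> \<open>Larger shells are empty, as \<open>2 ^ h * \<epsilon> / (2 * n) \<le> |y z k|
      \<le> \<epsilon> * b k\<close> and \<open>b k \<le> b jm\<close>.\<close>
    define H where "H = {h::nat. 2 ^ h \<le> 2 * real n * b jm}"
    have nb: "1 \<le> 2 * real n * b jm" using mult_mono[of 1 "2 * real n" 1 "b jm"] n1 b2[of jm] by simp
    have H: "finite H" "(\<Sum>h\<in>H. 2 ^ h) \<le> 2 * (2 * real n * b jm)"
      using powers_of_two_le[OF nb] by (simp_all add: H_def)
    have "Bad \<subseteq> (\<Union>h\<in>H. \<Union>z\<in>T h. hit z)"
    proof
      fix D assume "D \<in> Bad"
      then have D: "D \<in> digits N" and "\<not> no_short_vector \<epsilon> A' B' (child x w D)" by (auto simp: Bad_def)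
      then obtain q p where qp: "\<And>i. \<bar>(\<Sum>j\<in>UNIV. child x w D (i, j) * real_of_int (q j)) + real_of_int (p i)\<bar> < \<epsilon> * A' i"
          "\<And>j. \<bar>real_of_int (q j)\<bar> < \<epsilon> * B' j" and nz: "\<not> ((\<forall>j. q j = 0) \<and> (\<forall>i. p i = 0))"
        unfolding no_short_vector_def by blast
      define z where "z = (q, p)"
      define s where "s i = (\<Sum>j\<in>UNIV. real (D (i, j)) / (a i * b j) * y z j)" for i
      have Xs: "\<bar>X z i + s i\<bar> < \<epsilon> / a i" for i
      proof -
        have "(\<Sum>j\<in>UNIV. child x w D (i, j) * real_of_int (q j)) = lin i q + (\<Sum>j\<in>UNIV. real (D (i, j)) * w (i, j) * real_of_int (q j))"
          by (simp add: child_def lin_def algebra_simps sum.distrib)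
        also have "(\<Sum>j\<in>UNIV. real (D (i, j)) * w (i, j) * real_of_int (q j)) = A i * s i"
          unfolding s_def sum_distrib_left
          by (intro sum.cong) (use A[of i] a0[of i] in \<open>auto simp: w_def A'_def B'_def y_def z_def ac_simps\<close>)
        finally have eq: "(\<Sum>j\<in>UNIV. child x w D (i, j) * real_of_int (q j)) + real_of_int (p i) = A i * (X z i + s i)"
          using A[of i] by (simp add: X_def z_def field_simps)
        have "\<bar>A i * (X z i + s i)\<bar> < \<epsilon> * A' i" using qp(1)[of i] unfolding eq .
        then have "A i * \<bar>X z i + s i\<bar> < A i * (\<epsilon> / a i)"
          using A[of i] unfolding abs_mult by (simp add: A'_def mult.commute)
        then show ?thesis using A[of i] mult_less_cancel_left_pos by blast
      qed
      then have hitD: "D \<in> hit z" using D by (simp add: hit_def s_def)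
      have yb: "\<bar>y z j\<bar> < \<epsilon> * b j" for j
        using qp(2)[of j] B[of j] by (simp add: y_def z_def B'_def abs_divide pos_divide_less_eq algebra_simps)
      obtain k where k: "\<And>j. \<bar>y z j\<bar> \<le> \<bar>y z k\<bar>" using ex_argmax[of "\<lambda>j. \<bar>y z j\<bar>"] by blast
      define Y where "Y = \<bar>y z k\<bar>"
      have s_le: "\<bar>s i\<bar> \<le> n * Y" for i
      proof -
        have "\<bar>s i\<bar> \<le> (\<Sum>j\<in>UNIV. \<bar>real (D (i, j)) / (a i * b j) * y z j\<bar>)" unfolding s_def by (rule sum_abs)
        also have "\<dots> \<le> (\<Sum>j\<in>(UNIV::'n set). 1 * Y)"
        proof (rule sum_mono)
          fix j
          have "D (i, j) < N (i, j)" using D by (auto simp: digits_def PiE_iff)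
          then have "real (D (i, j)) \<le> real_of_int \<lfloor>a i * b j\<rfloor>" by (simp add: N_def grid_def)
          then have "real (D (i, j)) \<le> a i * b j" by linarith
          then have "\<bar>real (D (i, j)) / (a i * b j)\<bar> \<le> 1" using a0[of i] b0[of j] by (simp add: abs_divide divide_le_eq_1)
          then show "\<bar>real (D (i, j)) / (a i * b j) * y z j\<bar> \<le> 1 * Y"
            unfolding abs_mult Y_def using k[of j] by (intro mult_mono) auto
        qed
        finally show ?thesis by (simp add: n_def)
      qed
      have X_le: "\<bar>X z i\<bar> < \<epsilon> / 2 + n * Y" for i
      proof -
        have "\<epsilon> / a i \<le> \<epsilon> / 2" using \<epsilon> a2[of i] by (intro divide_left_mono) auto
        then show ?thesis using Xs[of i] s_le[of i] by linarith
      qed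
      \<comment> \<open>Otherwise all coordinates would be below \<open>\<epsilon>\<close> and the
        vector short already at the present scale; \<open>2 \<le> a i\<close> leaves half of
        \<open>\<epsilon>\<close> free for the term \<open>n * Y\<close>.\<close>
      have Y_ge: "\<epsilon> \<le> 2 * n * Y"
      proof (rule ccontr)
        assume "\<not> ?thesis"
        then have less: "2 * n * Y < \<epsilon>" by simp
        have X1: "\<bar>X z i\<bar> < \<epsilon>" for i using X_le[of i] less by linarith
        have 1: "\<bar>(\<Sum>j\<in>UNIV. x (i, j) * real_of_int (q j)) + real_of_int (p i)\<bar> < \<epsilon> * A i" for i
          using X1[of i] A[of i] by (simp add: X_def z_def lin_def abs_divide pos_divide_less_eq)
        have "1 * Y \<le> 2 * n * Y" using n1 by (intro mult_right_mono) (auto simp: Y_def)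
        then have y1: "\<bar>y z j\<bar> < \<epsilon>" for j using k[of j] less by (simp add: Y_def)
        have 2: "\<bar>real_of_int (q j)\<bar> < \<epsilon> * B j" for j
          using y1[of j] B[of j] by (simp add: y_def z_def abs_divide pos_divide_less_eq)
        from no_short 1 2 nz show False unfolding no_short_vector_def by blast
      qed
      then have "1 \<le> 2 * n * Y / \<epsilon>" using \<epsilon> by simp
      from power_bracket[OF _ this, of 2] obtain h where h: "2 ^ h \<le> 2 * n * Y / \<epsilon>" "2 * n * Y / \<epsilon> < 2 ^ Suc h" by auto
      have h1: "2 ^ h * \<epsilon> \<le> 2 * n * Y" and h2: "2 * n * Y \<le> 2 ^ Suc h * \<epsilon>" using h \<epsilon> by (simp_all add: field_simps)
      have "2 * n * Y \<le> 2 * n * (\<epsilon> * b jm)"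
      proof (rule mult_left_mono)
        have "\<epsilon> * b k \<le> \<epsilon> * b jm" using \<epsilon> by (intro mult_left_mono jm) simp
        then show "Y \<le> \<epsilon> * b jm" using yb[of k] by (simp add: Y_def)
      qed (use n0 in simp)
      then have "2 ^ h * \<epsilon> \<le> (2 * n * b jm) * \<epsilon>" using h1 by (simp add: algebra_simps)
      then have hH: "h \<in> H" using \<epsilon> by (simp add: H_def)
      have "\<bar>X z i\<bar> \<le> 2 ^ Suc h * \<epsilon>" for i using X_le[of i] Y_ge h2 by linarith
      moreover have "\<bar>y z j\<bar> \<le> 2 ^ h * \<epsilon> / n" for j
      proof -
        have "2 * (n * Y) \<le> 2 * (2 ^ h * \<epsilon>)" using h2 by (simp add: algebra_simps)
        then have "Y \<le> 2 ^ h * \<epsilon> / n" using n0 by (simp add: field_simps)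
        then show ?thesis using k[of j] by (simp add: Y_def)
      qed
      moreover have "2 ^ h * \<epsilon> / (2 * n) \<le> \<bar>y z k\<bar>" using h1 n0 by (simp add: Y_def field_simps)
      ultimately have "z \<in> T h" using less_imp_le[OF yb] unfolding T_def S_def by auto
      then show "D \<in> (\<Union>h\<in>H. \<Union>z\<in>T h. hit z)" using hH hitD by blast
    qed
    have T_fin: "finite (T h)" for h using S_fin[of h] by (simp add: T_def)
    have hit_fin: "finite (hit z)" for z by (simp add: hit_def)
    define F where "F h = real (card (S h)) * ((12 * n) ^ m / ((2 ^ h) ^ m * R))" for h
    have "card Bad \<le> card (\<Union>h\<in>H. \<Union>z\<in>T h. hit z)"
      by (intro card_mono finite_UN_I H T_fin hit_fin) fact
    also have "\<dots> \<le> (\<Sum>h\<in>H. card (\<Union>z\<in>T h. hit z))" by (rule card_UN_le[OF H(1)])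
    also have "\<dots> \<le> (\<Sum>h\<in>H. \<Sum>z\<in>T h. card (hit z))" by (intro sum_mono card_UN_le T_fin)
    finally have "real (card Bad) \<le> real (\<Sum>h\<in>H. \<Sum>z\<in>T h. card (hit z))" by (rule of_nat_mono)
    also have "\<dots> = (\<Sum>h\<in>H. \<Sum>z\<in>T h. real (card (hit z)))" by simp
    also have "\<dots> \<le> (\<Sum>h\<in>H. \<Sum>z\<in>T h. P * ((12 * n) ^ m / ((2 ^ h) ^ m * R)))"
      by (intro sum_mono hit_card)
    also have "\<dots> \<le> (\<Sum>h\<in>H. P * F h)"
    proof (rule sum_mono)
      fix h
      have "real (card (T h)) \<le> real (card (S h))" using S_fin by (simp add: card_mono T_def)
      then have "real (card (T h)) * (P * ((12 * n) ^ m / ((2 ^ h) ^ m * R))) \<le> real (card (S h)) * (P * ((12 * n) ^ m / ((2 ^ h) ^ m * R)))"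
        using P0 R0 by (intro mult_right_mono) auto
      then show "(\<Sum>z\<in>T h. P * ((12 * n) ^ m / ((2 ^ h) ^ m * R))) \<le> P * F h" by (simp add: F_def algebra_simps)
    qed
    also have "\<dots> = P * (\<Sum>h\<in>H. F h)" by (simp add: sum_distrib_left)
    also have "\<dots> \<le> P * (1 / 4 + 1 / 4)"
    proof (rule mult_left_mono[OF _ P0])
      have F0: "0 \<le> F h" for h using R0 by (simp add: F_def)
      have "(\<Sum>h\<in>H. F h) = (\<Sum>h\<in>H \<inter> {..<h0}. F h) + (\<Sum>h\<in>H - {..<h0}. F h)"
        using H(1) by (subst sum.union_disjoint[symmetric]) (auto intro!: sum.cong)
      also have "(\<Sum>h\<in>H \<inter> {..<h0}. F h) \<le> (\<Sum>h\<in>{..<h0}. F h)"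
        by (intro sum_mono2 F0) auto
      also have "\<dots> \<le> (\<Sum>h\<in>{..<h0}. C0 * (12 * n) ^ m / R)"
      proof (rule sum_mono)
        fix h assume "h \<in> {..<h0}"
        then have "F h \<le> C0 * ((12 * n) ^ m / (1 * R))"
          unfolding F_def using S_small[of h] C0 R0
          by (intro mult_mono divide_left_mono mult_right_mono mult_pos_pos) auto
        then show "F h \<le> C0 * (12 * n) ^ m / R" by simp
      qed
      also have "\<dots> \<le> 1 / 4" using L(3) LR R0 by (simp add: R_def[symmetric] field_simps)
      also have "(\<Sum>h\<in>H - {..<h0}. F h) \<le> (\<Sum>h\<in>H - {..<h0}. (24 * n) ^ m * 36 ^ d * \<epsilon> ^ d / b jm * 2 ^ h)"
      proof (rule sum_mono)
        fix h assume "h \<in> H - {..<h0}"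
        \<comment> \<open>\<open>(2 ^ h) ^ m\<close> and \<open>R\<close> cancel between the point
          count and the hitting proportion. What remains is proportional to
          \<open>2 ^ h / b jm\<close>, whose sum over \<open>H\<close> is at most
          \<open>4 * n\<close>.\<close>
        then have "F h \<le> 36 ^ d * 2 ^ m * \<epsilon> ^ d * (2 ^ h) ^ m * (2 ^ h * R / b jm) * ((12 * n) ^ m / ((2 ^ h) ^ m * R))"
          unfolding F_def using R0 by (intro mult_right_mono S_large) auto
        also have "\<dots> = (2 ^ m * (12 * n) ^ m) * 36 ^ d * \<epsilon> ^ d / b jm * 2 ^ h"
          using R0 by simp
        also have "2 ^ m * (12 * n) ^ m = (24 * n) ^ m" unfolding power_mult_distrib[symmetric] by simp
        finally show "F h \<le> (24 * n) ^ m * 36 ^ d * \<epsilon> ^ d / b jm * 2 ^ h" by simp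
      qed
      also have "\<dots> \<le> (\<Sum>h\<in>H. (24 * n) ^ m * 36 ^ d * \<epsilon> ^ d / b jm * 2 ^ h)"
        using \<epsilon> b0[of jm] H(1) by (intro sum_mono2) auto
      also have "\<dots> = (24 * n) ^ m * 36 ^ d * \<epsilon> ^ d / b jm * (\<Sum>h\<in>H. 2 ^ h)" by (simp add: sum_distrib_left)
      also have "\<dots> \<le> (24 * n) ^ m * 36 ^ d * \<epsilon> ^ d / b jm * (2 * (2 * real n * b jm))"
        using \<epsilon> b0[of jm] by (intro mult_left_mono H(2)) auto
      also have "\<dots> = failure_bound m n * \<epsilon> ^ d" using b0[of jm] by (simp add: failure_bound_def d_def)
      also have "\<dots> \<le> 1 / 4" using small by (simp add: d_def)
      finally show "(\<Sum>h\<in>H. F h) \<le> 1 / 4 + 1 / 4" by simp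
    qed
    finally have Bad_le: "real (card Bad) \<le> P / 2" by simp
    define Good where "Good = {D \<in> digits N. no_short_vector \<epsilon> A' B' (child x w D)}"
    have "card (digits N) = card Good + card Bad"
      unfolding Good_def Bad_def by (subst card_Un_disjoint[symmetric]) (auto intro!: arg_cong[where f=card])
    moreover have "real (card (digits N)) = P" by (simp add: P_def digits_def card_PiE)
    ultimately have "P / 2 \<le> real (card Good)" using Bad_le by simp
    then show "(\<Prod>e\<in>UNIV. real (grid a b e)) / 2 \<le> real (card {D \<in> digits (grid a b).
      no_short_vector \<epsilon> (\<lambda>i. A i / a i) (\<lambda>j. B j * b j) (child x (\<lambda>(i, j). (A i / a i) / (B j * b j)) D)})"
      by (simp add: P_def N_def Good_def A'_def[abs_def] B'_def[abs_def] w_def)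
  qed
qed

section \<open>Badly approximable matrices\<close>

text \<open>The family is finite, so the largest threshold and the smallest exponent serve all
  members; lowering the exponent weakens the bound because \<open>R > 1\<close>.\<close>

lemma quasimultiplicative_family_growth:
  fixes h :: "'i::finite \<Rightarrow> real \<Rightarrow> real"
  assumes "\<And>i. quasimultiplicative_on I (h i)"
  shows "\<exists>R0 \<kappa>. 1 < R0 \<and> 0 < \<kappa> \<and>
    (\<forall>i R T. R0 \<le> R \<longrightarrow> T \<in> I \<longrightarrow> R * T \<in> I \<longrightarrow> R powr \<kappa> * h i T \<le> h i (R * T))"
proof -
  have "\<exists>p. 1 < fst p \<and> 0 < snd p \<and>
    (\<forall>R\<ge>fst p. \<forall>T>0. T \<in> I \<and> R * T \<in> I \<longrightarrow> R powr (snd p) * h i T \<le> h i (R * T))" for i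
    using assms[of i] unfolding quasimultiplicative_on_def by (metis fst_conv snd_conv)
  then have "\<exists>p. \<forall>i. 1 < fst (p i) \<and> 0 < snd (p i) \<and>
    (\<forall>R\<ge>fst (p i). \<forall>T>0. T \<in> I \<and> R * T \<in> I \<longrightarrow> R powr (snd (p i)) * h i T \<le> h i (R * T))"
    by (intro choice allI)
  then obtain p where p: "\<And>i. 1 < fst (p i)" "\<And>i. 0 < snd (p i)"
    "\<And>i R T. fst (p i) \<le> R \<Longrightarrow> 0 < T \<Longrightarrow> T \<in> I \<Longrightarrow> R * T \<in> I \<Longrightarrow> R powr (snd (p i)) * h i T \<le> h i (R * T)"
    by blast
  obtain i1 where i1: "\<And>i. fst (p i) \<le> fst (p i1)" using ex_argmax[of "\<lambda>i. fst (p i)"] by blast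
  obtain i2 where i2: "\<And>i. - snd (p i) \<le> - snd (p i2)" using ex_argmax[of "\<lambda>i. - snd (p i)"] by blast
  have "R powr (snd (p i2)) * h i T \<le> h i (R * T)"
    if R: "fst (p i1) \<le> R" and T: "T \<in> I" "R * T \<in> I" for i R T
  proof -
    have T0: "0 < T" "0 < h i T" using assms[of i] T unfolding quasimultiplicative_on_def by auto
    have "R powr (snd (p i2)) * h i T \<le> R powr (snd (p i)) * h i T"
      using i2[of i] R p(1)[of i1] T0 by (intro mult_right_mono powr_mono) auto
    also have "\<dots> \<le> h i (R * T)" using R i1[of i] T0 T by (intro p(3)) auto
    finally show ?thesis .
  qed
  then show ?thesis using p(1)[of i1] p(2)[of i2] by (intro exI[of _ "fst (p i1)"] exI[of _ "snd (p i2)"]) auto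
qed

section \<open>From the discrete scales to bad approximability\<close>

lemma dist_int_less:
  assumes "dist_int x < c"
  shows "\<exists>p::int. \<bar>x + real_of_int p\<bar> < c"
proof -
  have "(INF a\<in>\<int>. dist x a) < c" using assms by (simp add: dist_int_def infdist_def Ints_def)
  then obtain a where "a \<in> \<int>" "dist x a < c"
    by (subst (asm) cINF_less_iff) (auto intro: bdd_belowI2[where m=0] simp: Ints_def)
  then obtain k where "\<bar>x - real_of_int k\<bar> < c" by (auto simp: Ints_def dist_real_def)
  then show ?thesis by (intro exI[of _ "- k"]) simp
qed

text \<open>Passes from the corner of a box to each of its points. Changing the entries of row
  \<open>i\<close> by at most \<open>A i / B j\<close> moves the form by at most
  \<open>n * e * A i\<close> when \<open>|q j| < e * B j\<close>, and
  \<open>(n + 1) * e = \<epsilon>\<close>.\<close>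

lemma no_short_vector_perturb:
  fixes A :: "'m::finite \<Rightarrow> real" and B :: "'n::finite \<Rightarrow> real"
  assumes no_short: "no_short_vector \<epsilon> A B x" and \<epsilon>: "0 < \<epsilon>"
    and A: "\<And>i. 0 < A i" and B: "\<And>j. 0 < B j"
    and close: "\<And>i j. \<bar>z (i, j) - x (i, j)\<bar> \<le> A i / B j"
  shows "no_short_vector (\<epsilon> / (CARD('n) + 1)) A B z"
  unfolding no_short_vector_def
proof (intro allI impI, elim conjE)
  fix q :: "'n \<Rightarrow> int" and p :: "'m \<Rightarrow> int"
  define n where "n = real CARD('n)"
  define e where "e = \<epsilon> / (CARD('n) + 1)"
  assume p: "\<forall>i. \<bar>(\<Sum>j\<in>UNIV. z (i, j) * real_of_int (q j)) + real_of_int (p i)\<bar> < \<epsilon> / (CARD('n) + 1) * A i"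
    and q: "\<forall>j. \<bar>real_of_int (q j)\<bar> < \<epsilon> / (CARD('n) + 1) * B j"
  have n: "0 \<le> n" by (simp add: n_def)
  have "(n + 1) * e = \<epsilon>" using n by (simp add: e_def n_def add.commute)
  then have e: "n * e + e = \<epsilon>" by (simp only: distrib_right mult_1_left)
  have e0: "0 < e" using \<epsilon> by (simp add: e_def)
  have "e \<le> \<epsilon>" using e e0 n mult_nonneg_nonneg[of n e] by linarith
  have "\<bar>real_of_int (q j)\<bar> < \<epsilon> * B j" for j
    using q[rule_format, of j] mult_right_mono[OF \<open>e \<le> \<epsilon>\<close>, of "B j"] B[of j] by (simp add: e_def)
  moreover have "\<bar>(\<Sum>j\<in>UNIV. x (i, j) * real_of_int (q j)) + real_of_int (p i)\<bar> < \<epsilon> * A i" for i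
  proof -
    have "\<bar>\<Sum>j\<in>UNIV. (z (i, j) - x (i, j)) * real_of_int (q j)\<bar> \<le> (\<Sum>j\<in>UNIV. \<bar>(z (i, j) - x (i, j)) * real_of_int (q j)\<bar>)"
      by (rule sum_abs)
    also have "\<dots> \<le> (\<Sum>j\<in>(UNIV::'n set). A i * e)"
    proof (rule sum_mono)
      fix j
      have "\<bar>(z (i, j) - x (i, j)) * real_of_int (q j)\<bar> \<le> (A i / B j) * (e * B j)"
        unfolding abs_mult using q[rule_format, of j] close[of i j] A[of i] B[of j]
        by (intro mult_mono) (auto simp: e_def)
      then show "\<bar>(z (i, j) - x (i, j)) * real_of_int (q j)\<bar> \<le> A i * e" using B[of j] by simp
    qed
    also have "\<dots> = n * e * A i" by (simp add: n_def)
    also have "(\<Sum>j\<in>UNIV. (z (i, j) - x (i, j)) * real_of_int (q j))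
      = (\<Sum>j\<in>UNIV. z (i, j) * real_of_int (q j)) - (\<Sum>j\<in>UNIV. x (i, j) * real_of_int (q j))"
      by (simp add: sum_subtractf algebra_simps)
    finally have "\<bar>(\<Sum>j\<in>UNIV. x (i, j) * real_of_int (q j)) + real_of_int (p i)\<bar> < n * e * A i + e * A i"
      using p[rule_format, of i] unfolding e_def[symmetric] by linarith
    also have "\<dots> = \<epsilon> * A i" unfolding e[symmetric] by (simp only: distrib_right)
    finally show ?thesis .
  qed
  ultimately show "(\<forall>j. q j = 0) \<and> (\<forall>i. p i = 0)" using no_short unfolding no_short_vector_def by blast
qed

lemma powr_exceeds:
  fixes C p :: real
  assumes "0 < p"
  shows "\<exists>R1. \<forall>R\<ge>R1. C < R powr p"
proof (intro exI allI impI)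
  fix R assume R: "(\<bar>C\<bar> + 1) powr (1 / p) \<le> R"
  have "C < \<bar>C\<bar> + 1" by linarith
  also have "\<dots> = ((\<bar>C\<bar> + 1) powr (1 / p)) powr p" using assms by (simp add: powr_powr)
  also have "\<dots> \<le> R powr p" using R assms by (intro powr_mono2) auto
  finally show "C < R powr p" .
qed

locale weight_functions =
  fixes \<alpha> :: "'m::finite \<Rightarrow> real \<Rightarrow> real" and \<beta> :: "'n::finite \<Rightarrow> real \<Rightarrow> real" and \<kappa> R0 :: real
  assumes \<alpha>_mono: "0 < s \<Longrightarrow> s \<le> t \<Longrightarrow> t \<le> 1 \<Longrightarrow> \<alpha> i s \<le> \<alpha> i t"
    and \<alpha>_pos: "0 < t \<Longrightarrow> t \<le> 1 \<Longrightarrow> 0 < \<alpha> i t"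
    and \<alpha>_le_1: "0 < t \<Longrightarrow> t \<le> 1 \<Longrightarrow> \<alpha> i t \<le> 1"
    and \<alpha>_growth: "R0 \<le> R \<Longrightarrow> 0 < t \<Longrightarrow> R * t \<le> 1 \<Longrightarrow> R powr \<kappa> * \<alpha> i t \<le> \<alpha> i (R * t)"
    and \<alpha>_prod: "1 \<le> T \<Longrightarrow> (\<Prod>i\<in>UNIV. \<alpha> i (1 / T)) = 1 / T"
    and \<beta>_mono: "1 \<le> S \<Longrightarrow> S \<le> T \<Longrightarrow> \<beta> j S \<le> \<beta> j T"
    and \<beta>_ge_1: "1 \<le> T \<Longrightarrow> 1 \<le> \<beta> j T"
    and \<beta>_growth: "R0 \<le> R \<Longrightarrow> 1 \<le> T \<Longrightarrow> R powr \<kappa> * \<beta> j T \<le> \<beta> j (R * T)"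
    and \<beta>_prod: "1 \<le> T \<Longrightarrow> (\<Prod>j\<in>UNIV. \<beta> j T) = T"
    and R0: "1 < R0" and \<kappa>: "0 < \<kappa>"
begin

text \<open>A solution at \<open>T\<close> gives a short vector at the scale \<open>V\<close>, two
  steps above the last scale not exceeding \<open>T\<close>. Of the three powers of
  \<open>R\<close>, one rounds \<open>T\<close> up to \<open>S\<close>, one pays for the gap from
  \<open>S\<close> to \<open>V\<close> over which \<open>\<beta>\<close> gains the factor
  \<open>1 / \<epsilon>\<close>, and one for the gap from \<open>V\<close> to \<open>R * V\<close>
  over which \<open>\<alpha>\<close> does the same.\<close>

lemma badly_approximableI:
  fixes \<Theta> :: "real^'n^'m"
  assumes R: "R0 \<le> R" and T0: "1 \<le> T0" and \<epsilon>: "0 < \<epsilon>" and R\<epsilon>: "1 / \<epsilon> < R powr \<kappa>"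
    and no_short: "\<And>k. no_short_vector \<epsilon> (\<lambda>i. \<alpha> i (1 / (R ^ k * T0))) (\<lambda>j. \<beta> j (R ^ k * T0)) (\<lambda>(i, j). \<Theta> $ i $ j)"
  shows "badly_approximable \<alpha> \<beta> \<Theta>"
  unfolding badly_approximable_def approximable_def not_not
proof (intro exI conjI)
  have R1: "1 < R" using R R0 by simp
  have shrink: "u < \<epsilon> * v" if "R powr \<kappa> * u \<le> v" "0 < u" for u v :: real
  proof -
    have "1 / \<epsilon> * u < R powr \<kappa> * u" using R\<epsilon> that(2) by (intro mult_strict_right_mono)
    then have "1 / \<epsilon> * u < v" using that(1) by linarith
    then show ?thesis using \<epsilon> by (simp add: field_simps)
  qed
  show "0 < 1 / R ^ 3" using R1 by simp
  show "bdd_above {T. 1 \<le> T \<and> 1 / R ^ 3 * (1 / T) \<le> 1 \<and>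
    (\<exists>q :: int^'n. q \<noteq> 0 \<and>
      (\<forall>i. dist_int (\<Sum>j\<in>UNIV. \<Theta> $ i $ j * of_int (q $ j)) \<le> \<alpha> i (1 / R ^ 3 * (1 / T))) \<and>
      (\<forall>j. of_int \<bar>q $ j\<bar> \<le> \<beta> j T))}"
  proof (rule bdd_aboveI[of _ T0], clarify, rule ccontr)
    fix T and q :: "int^'n"
    assume T: "1 \<le> T" and q0: "q \<noteq> 0"
      and \<Theta>q: "\<forall>i. dist_int (\<Sum>j\<in>UNIV. \<Theta> $ i $ j * of_int (q $ j)) \<le> \<alpha> i (1 / R ^ 3 * (1 / T))"
      and q: "\<forall>j. of_int \<bar>q $ j\<bar> \<le> \<beta> j T" and "\<not> T \<le> T0"
    then have "1 \<le> T / T0" using T0 by simp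
    from power_bracket[OF R1 this] obtain k where k: "R ^ k \<le> T / T0" "T / T0 < R ^ Suc k" by blast
    define S where "S = R ^ Suc k * T0"
    have TS: "T \<le> S" using k(2) T0 by (simp add: S_def field_simps)
    have S1: "1 \<le> S" using TS T by simp
    define V where "V = R ^ Suc (Suc k) * T0"
    have V: "V = R * S" by (simp add: V_def S_def)
    have V1: "1 \<le> V" unfolding V using R1 S1 mult_mono[of 1 R 1 S] by simp
    have qV: "\<bar>real_of_int (q $ j)\<bar> < \<epsilon> * \<beta> j V" for j
    proof -
      have "\<bar>real_of_int (q $ j)\<bar> \<le> \<beta> j T" using q[rule_format, of j] by simp
      also have "\<dots> \<le> \<beta> j S" using T TS by (intro \<beta>_mono)
      also have "\<dots> < \<epsilon> * \<beta> j V"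
        unfolding V using \<beta>_growth[OF R S1, of j] \<beta>_ge_1[OF S1, of j] by (intro shrink) auto
      finally show ?thesis .
    qed
    have "\<exists>p::int. \<bar>(\<Sum>j\<in>UNIV. \<Theta> $ i $ j * of_int (q $ j)) + real_of_int p\<bar> < \<epsilon> * \<alpha> i (1 / V)" for i
    proof (rule dist_int_less)
      have "R * V \<le> R ^ 3 * T"
        using k(1) T0 R1 by (simp add: V_def field_simps power3_eq_cube)
      then have "1 / R ^ 3 * (1 / T) \<le> 1 / (R * V)"
        using R1 V1 T by (simp add: frac_le)
      moreover have "1 / (R * V) \<le> 1" using mult_mono[of 1 R 1 V] R1 V1 by simp
      ultimately have "\<alpha> i (1 / R ^ 3 * (1 / T)) \<le> \<alpha> i (1 / (R * V))"
        using R1 T by (intro \<alpha>_mono) auto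
      also have "\<dots> < \<epsilon> * \<alpha> i (1 / V)"
      proof (rule shrink)
        have eq: "R * (1 / (R * V)) = 1 / V" using R1 by simp
        show "R powr \<kappa> * \<alpha> i (1 / (R * V)) \<le> \<alpha> i (1 / V)"
          using \<alpha>_growth[of R "1 / (R * V)" i] R R1 V1 unfolding eq by simp
        show "0 < \<alpha> i (1 / (R * V))" using \<open>1 / (R * V) \<le> 1\<close> R1 V1 by (intro \<alpha>_pos) auto
      qed
      finally show "dist_int (\<Sum>j\<in>UNIV. \<Theta> $ i $ j * of_int (q $ j)) < \<epsilon> * \<alpha> i (1 / V)"
        using \<Theta>q[rule_format, of i] by linarith
    qed
    then have "\<exists>p. \<forall>i. \<bar>(\<Sum>j\<in>UNIV. \<Theta> $ i $ j * of_int (q $ j)) + real_of_int (p i)\<bar> < \<epsilon> * \<alpha> i (1 / V)"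
      by (intro choice allI)
    then obtain p :: "'m \<Rightarrow> int"
      where pV: "\<And>i. \<bar>(\<Sum>j\<in>UNIV. \<Theta> $ i $ j * of_int (q $ j)) + real_of_int (p i)\<bar> < \<epsilon> * \<alpha> i (1 / V)" by blast
    have "no_short_vector \<epsilon> (\<lambda>i. \<alpha> i (1 / V)) (\<lambda>j. \<beta> j V) (\<lambda>(i, j). \<Theta> $ i $ j)"
      using no_short[of "Suc (Suc k)"] by (simp only: V_def)
    from this[unfolded no_short_vector_def, THEN spec[where x="\<lambda>j. q $ j"], THEN spec[where x=p]] qV pV
    have "\<forall>j. q $ j = 0" by simp
    then show False using q0 by (simp add: vec_eq_iff)
  qed
qed

end

section \<open>The Cantor set and its dimension\<close>

lemma norm_matrix_le:
  fixes \<Theta> :: "real^'n^'m"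
  assumes "\<And>i j. \<bar>\<Theta> $ i $ j\<bar> \<le> w"
  shows "norm \<Theta> \<le> real (CARD('m) * CARD('n)) * w"
proof -
  have "norm \<Theta> \<le> (\<Sum>i\<in>UNIV. norm (\<Theta> $ i))" unfolding norm_vec_def by (rule L2_set_le_sum) simp
  also have "\<dots> \<le> (\<Sum>i\<in>(UNIV::'m set). \<Sum>j\<in>(UNIV::'n set). w)"
    using assms by (intro sum_mono order_trans[OF norm_le_l1_cart]) auto
  finally show ?thesis by simp
qed

context weight_functions
begin

text \<open>Each level of the construction keeps at least a fixed proportion \<open>c\<close> of the volume, while the sides
  shrink by \<open>R powr (2 * \<kappa>)\<close>. So the dimension lost is at most \<open>- ln c / (2 * \<kappa> * ln R)\<close>, which
  is made smaller than \<open>m * n - s\<close> by choosing \<open>R\<close> last.\<close>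

lemma hausdorff_measure_badly_approximable:
  fixes U :: "(real^'n^'m) set"
  assumes U: "open U" "U \<noteq> {}" and s: "0 < s" "s < real (CARD('m) * CARD('n))"
  shows "hausdorff_measure s ({\<Theta>. badly_approximable \<alpha> \<beta> \<Theta>} \<inter> U) \<noteq> 0"
proof
  assume null: "hausdorff_measure s ({\<Theta>. badly_approximable \<alpha> \<beta> \<Theta>} \<inter> U) = 0"
  define mn where "mn = CARD('m) * CARD('n)"
  define \<eta> where "\<eta> = real mn - s"
  have \<eta>: "0 < \<eta>" using s by (simp add: \<eta>_def mn_def)
  obtain \<Theta>0 where "\<Theta>0 \<in> U" using U by auto
  with \<open>open U\<close> obtain \<delta> where \<delta>: "0 < \<delta>" "ball \<Theta>0 \<delta> \<subseteq> U" by (auto simp: open_contains_ball)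
  obtain T0' where T0': "\<And>T. T0' \<le> T \<Longrightarrow> real mn / \<delta> < T powr \<kappa>"
    using powr_exceeds[OF \<kappa>, of "real mn / \<delta>"] by blast
  \<comment> \<open>At this scale all sides are at most \<open>1 / T0 powr \<kappa>\<close>, which
    keeps the starting box with corner \<open>\<Theta>0\<close> inside the ball of radius
    \<open>\<delta>\<close>. \<open>R0 \<le> T0\<close> allows the growth bound between
    \<open>1 / T0\<close> and 1.\<close>
  define T0 where "T0 = max T0' R0"
  have T0: "real mn / \<delta> < T0 powr \<kappa>" "R0 \<le> T0" "1 < T0" using T0'[of T0] R0 by (auto simp: T0_def)
  have \<alpha>T0: "\<alpha> i (1 / T0) \<le> 1 / T0 powr \<kappa>" for i
  proof -
    have "T0 powr \<kappa> * \<alpha> i (1 / T0) \<le> \<alpha> i (T0 * (1 / T0))" using T0 by (intro \<alpha>_growth) auto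
    also have "\<dots> \<le> 1" using T0 by (simp add: \<alpha>_le_1)
    finally show ?thesis using T0 by (simp add: field_simps)
  qed

  define C where "C = failure_bound CARD('m) CARD('n)"
  have C: "0 \<le> C" by (simp add: C_def failure_bound_def)
  define d where "d = CARD('m) + CARD('n)"
  define b1 where "b1 = (\<Sum>j\<in>UNIV. \<beta> j T0)"
  have \<beta>0: "0 \<le> \<beta> j T0" for j using \<beta>_ge_1[of T0 j] T0 by simp
  have \<beta>b1: "\<beta> j T0 \<le> b1" for j
    unfolding b1_def by (intro member_le_sum \<beta>0) auto
  have b1: "1 \<le> b1" using \<beta>_ge_1[of T0 undefined] \<beta>b1[of undefined] T0 by simp
  \<comment> \<open>\<open>\<epsilon> * b1 \<le> 1\<close> and \<open>\<epsilon> \<le> 1\<close>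
    force \<open>q = 0\<close> and then \<open>p = 0\<close> at scale \<open>T0\<close>, so the
    starting box is admissible whatever \<open>\<Theta>0\<close> is; \<open>4 * C\<close> serves
    \<open>half_of_children\<close>.\<close>
  define \<epsilon> where "\<epsilon> = 1 / (4 * C + b1)"
  have \<epsilon>: "0 < \<epsilon>" "\<epsilon> \<le> 1" "\<epsilon> * b1 \<le> 1" "C * \<epsilon> \<le> 1 / 4"
    using C b1 by (auto simp: \<epsilon>_def field_simps)
  have "\<epsilon> ^ d \<le> \<epsilon> ^ 1" using \<epsilon> by (intro power_decreasing) (auto simp: d_def Suc_le_eq)
  then have "C * \<epsilon> ^ d \<le> C * \<epsilon>" using C by (simp add: mult_left_mono)
  then have small: "failure_bound CARD('m) CARD('n) * \<epsilon> ^ (CARD('m) + CARD('n)) \<le> 1 / 4"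
    using \<epsilon>(4) by (simp add: C_def d_def)
  obtain L where L: "2 \<le> L" and half:
    "\<And>(A :: 'm \<Rightarrow> real) (B :: 'n \<Rightarrow> real) a b x.
      (\<forall>i. 0 < A i) \<and> (\<forall>j. 0 < B j) \<and> (\<Prod>i\<in>UNIV. A i) * (\<Prod>j\<in>UNIV. B j) = 1 \<and>
      (\<forall>i. L \<le> a i) \<and> (\<forall>j. L \<le> b j) \<and> (\<Prod>i\<in>UNIV. a i) = (\<Prod>j\<in>UNIV. b j) \<and> L \<le> (\<Prod>j\<in>UNIV. b j) \<and>
      no_short_vector \<epsilon> A B x \<Longrightarrow>
      (\<Prod>e\<in>UNIV. real (grid a b e)) / 2 \<le> real (card {D \<in> digits (grid a b).
        no_short_vector \<epsilon> (\<lambda>i. A i / a i) (\<lambda>j. B j * b j) (child x (\<lambda>(i, j). (A i / a i) / (B j * b j)) D)})"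
    using half_of_children[where 'm='m and 'n='n, OF \<epsilon>(1) small] by blast

  define \<epsilon>' where "\<epsilon>' = \<epsilon> / (CARD('n) + 1)"
  have \<epsilon>': "0 < \<epsilon>'" using \<epsilon> by (simp add: \<epsilon>'_def)
  \<comment> \<open>Rounding in \<open>grid\<close> keeps at least half of the side in each of the
    \<open>mn\<close> entries, and at least half of the children survive.\<close>
  define c :: real where "c = 1 / 2 ^ Suc mn"
  have "1 \<le> (2::real) ^ Suc mn" by (rule one_le_power) simp
  then have c: "0 < c" "c \<le> 1" by (auto simp: c_def divide_le_eq)
  \<comment> \<open>\<open>L\<close> is needed for the factors \<open>a\<close> and
    \<open>b\<close>, and \<open>1 / \<epsilon>'\<close> for \<open>badly_approximableI\<close>. The
    next condition makes the shrinking \<open>R powr (- (2 * \<kappa>))\<close>, raised to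
    \<open>\<eta>\<close>, outweigh the loss \<open>c\<close> per level.\<close>
  obtain R1 where R1: "\<And>R. R1 \<le> R \<Longrightarrow> max L (1 / \<epsilon>') < R powr \<kappa>" using powr_exceeds[OF \<kappa>] by blast
  obtain R2 where R2: "\<And>R. R2 \<le> R \<Longrightarrow> 1 / c < R powr (2 * \<kappa> * \<eta>)"
    using powr_exceeds[of "2 * \<kappa> * \<eta>" "1 / c"] \<kappa> \<eta> by auto
  define R where "R = Max {R0, R1, R2, L}"
  have R: "R0 \<le> R" "L \<le> R" "max L (1 / \<epsilon>') < R powr \<kappa>" "1 / c < R powr (2 * \<kappa> * \<eta>)" "1 < R"
    using R1[of R] R2[of R] R0 by (auto simp: R_def)

  define T where "T k = R ^ k * T0" for k
  have T1: "1 \<le> T k" for k using T0 R mult_mono[of 1 "R ^ k" 1 T0] by (simp add: T_def one_le_power)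
  have T_Suc: "T (Suc k) = R * T k" for k by (simp add: T_def)
  define A where "A k i = \<alpha> i (1 / T k)" for k i
  define B where "B k j = \<beta> j (T k)" for k j
  have A: "0 < A k i" and A1: "A k i \<le> 1" for k i using T1[of k] by (auto simp: A_def \<alpha>_pos \<alpha>_le_1)
  have B1: "1 \<le> B k j" for k j using T1[of k] by (simp add: B_def \<beta>_ge_1)
  have B: "0 < B k j" for k j using B1[of k j] by simp
  have covol: "(\<Prod>i\<in>UNIV. A k i) * (\<Prod>j\<in>UNIV. B k j) = 1" for k
    using T1[of k] by (simp add: A_def B_def \<alpha>_prod \<beta>_prod)
  define a where "a k i = A k i / A (Suc k) i" for k i
  define b where "b k j = B (Suc k) j / B k j" for k j
  have Aa: "A k i / a k i = A (Suc k) i" for k i using A[of k i] by (simp add: a_def)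
  have Bb: "B k j * b k j = B (Suc k) j" for k j using B[of k j] by (simp add: b_def)
  have a_ge: "R powr \<kappa> \<le> a k i" for k i
  proof -
    have eq: "R * (1 / T (Suc k)) = 1 / T k" using R by (simp add: T_Suc)
    have "R powr \<kappa> * \<alpha> i (1 / T (Suc k)) \<le> \<alpha> i (R * (1 / T (Suc k)))"
    proof (rule \<alpha>_growth[OF R(1)])
      show "0 < 1 / T (Suc k)" using T1[of "Suc k"] by simp
      show "R * (1 / T (Suc k)) \<le> 1" unfolding eq using T1[of k] by simp
    qed
    then have "R powr \<kappa> * A (Suc k) i \<le> A k i" unfolding eq by (simp add: A_def)
    then show ?thesis using A[of "Suc k" i] by (simp add: a_def pos_le_divide_eq)
  qed
  have b_ge: "R powr \<kappa> \<le> b k j" for k j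
    using \<beta>_growth[OF R(1) T1[of k], of j] B[of k j] by (simp add: b_def B_def T_Suc pos_le_divide_eq)
  have aL: "L \<le> a k i" and bL: "L \<le> b k j" for k i j using a_ge[of k i] b_ge[of k j] R(3) by auto
  have a_prod: "(\<Prod>i\<in>UNIV. a k i) = R" for k
    using T1[of k] T1[of "Suc k"] R by (simp add: a_def A_def prod_dividef \<alpha>_prod) (simp add: T_Suc)
  have b_prod: "(\<Prod>j\<in>UNIV. b k j) = R" for k
    using T1[of k] T1[of "Suc k"] R by (simp add: b_def B_def prod_dividef \<beta>_prod) (simp add: T_Suc)

  define w where "w k = (\<lambda>(i, j). A k i / B k j)" for k
  have w: "0 < w k e" for k e using A B by (auto simp: w_def split: prod.split)
  define N where "N k = grid (a k) (b k)" for k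
  have w_step: "w k (i, j) = a k i * b k j * w (Suc k) (i, j)" for k i j
    using A[of "Suc k" i] B[of k j] B[of "Suc k" j] by (simp add: w_def a_def b_def)
  have ab1: "1 \<le> a k i" "1 \<le> b k j" for k i j using aL[of k i] bL[of k j] L by auto
  have N_w: "real (N k e) * w (Suc k) e \<le> w k e" for k e
  proof (cases e)
    case (Pair i j)
    have "0 \<le> a k i * b k j" using ab1(1)[of k i] ab1(2)[of k j] by simp
    then have "real (N k e) \<le> a k i * b k j" unfolding N_def grid_def Pair by (simp add: of_nat_nat)
    then show ?thesis unfolding Pair w_step[of k] using w[of "Suc k" "(i, j)"] by (intro mult_right_mono) auto
  qed
  have N_ge: "w k e / 2 \<le> real (N k e) * w (Suc k) e" for k e
  proof (cases e)
    case (Pair i j)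
    have "a k i * b k j / 2 \<le> real (N k e)" unfolding N_def Pair by (intro grid_ge ab1)
    then have "a k i * b k j / 2 * w (Suc k) e \<le> real (N k e) * w (Suc k) e"
      using w[of "Suc k" e] by (intro mult_right_mono) auto
    then show ?thesis unfolding Pair w_step[of k] by simp
  qed
  define M where "M k = (\<Prod>e\<in>UNIV. real (N k e)) / 2" for k
  have M: "0 < M k" for k
  proof -
    have "0 < real (N k e)" for e using N_ge[of k e] w[of k e] w[of "Suc k" e] by (smt (verit) mult_nonneg_nonneg mult_eq_0_iff of_nat_0_le_iff half_gt_zero)
    then show ?thesis by (simp add: M_def prod_pos)
  qed
  \<comment> \<open>Volume of one box times the guaranteed number of boxes: a lower bound for the
    volume left at level \<open>k\<close>.\<close>
  define W where "W k = (\<Prod>e\<in>UNIV. w k e) * (\<Prod>l<k. M l)" for k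
  define W0 where "W0 = (\<Prod>e\<in>UNIV. w 0 e)"
  have W0: "0 < W0" unfolding W0_def using w by (simp add: prod_pos)
  have W_ge: "W0 * c ^ k \<le> W k" for k
  proof (induction k)
    case 0 then show ?case by (simp add: W_def W0_def)
  next
    case (Suc k)
    have "(\<Prod>e\<in>(UNIV :: ('m \<times> 'n) set). w k e / 2) \<le> (\<Prod>e\<in>UNIV. real (N k e) * w (Suc k) e)"
      using w N_ge by (intro prod_mono conjI) (auto intro: less_imp_le)
    then have "(\<Prod>e\<in>UNIV. w k e) / 2 ^ mn / 2 \<le> M k * (\<Prod>e\<in>UNIV. w (Suc k) e)"
      unfolding prod_dividef prod.distrib by (simp add: M_def mn_def)
    then have "(\<Prod>e\<in>UNIV. w k e) * c \<le> M k * (\<Prod>e\<in>UNIV. w (Suc k) e)"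
      by (simp add: c_def mult.commute)
    then have "(\<Prod>e\<in>UNIV. w k e) * c * (\<Prod>l<k. M l) \<le> M k * (\<Prod>e\<in>UNIV. w (Suc k) e) * (\<Prod>l<k. M l)"
      using M by (intro mult_right_mono prod_nonneg) (auto intro: less_imp_le)
    then have "W k * c \<le> W (Suc k)" by (simp add: W_def mult_ac)
    moreover have "W0 * c ^ Suc k \<le> W k * c" using Suc c by (simp add: mult_right_mono)
    ultimately show ?case by linarith
  qed

  define \<theta> where "\<theta> = R powr (- (2 * \<kappa>))"
  have \<theta>: "0 < \<theta>" using R by (simp add: \<theta>_def)
  have w_Suc: "w (Suc k) e \<le> \<theta> * w k e" for k e
  proof (cases e)
    case (Pair i j)
    have "R powr \<kappa> * R powr \<kappa> \<le> a k i * b k j" using a_ge b_ge ab1(1)[of k i] by (intro mult_mono) (auto intro: order_trans[OF zero_le_one])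
    then have "R powr (2 * \<kappa>) \<le> a k i * b k j" by (simp flip: powr_add)
    then have "R powr (2 * \<kappa>) * w (Suc k) e \<le> w k e"
      unfolding Pair w_step[of k] using w[of "Suc k" "(i, j)"] by (intro mult_right_mono) auto
    then show ?thesis using R by (simp add: \<theta>_def powr_minus field_simps)
  qed
  have w0: "w 0 e \<le> 1 / T0 powr \<kappa>" for e
  proof (cases e)
    case (Pair i j)
    have "A 0 i / B 0 j \<le> A 0 i / 1" using A[of 0 i] B1[of 0 j] by (intro divide_left_mono) auto
    then show ?thesis using \<alpha>T0[of i] by (simp add: Pair w_def A_def T_def)
  qed
  have "1 \<le> T0 powr \<kappa>" using T0 \<kappa> by (intro ge_one_powr_ge_zero) auto
  then have "1 / T0 powr \<kappa> \<le> 1" using T0(3) by (subst divide_le_eq_1_pos) auto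
  then have w0_1: "w 0 e \<le> 1" for e using w0[of e] by linarith
  have w_le: "w k e \<le> \<theta> ^ k" for k e
  proof (induction k)
    case (Suc k)
    have "w (Suc k) e \<le> \<theta> * w k e" by (rule w_Suc)
    also have "\<dots> \<le> \<theta> * \<theta> ^ k" using Suc \<theta> by (intro mult_left_mono) auto
    finally show ?case by simp
  qed (simp add: w0_1)
  have \<theta>\<eta>: "\<theta> powr \<eta> \<le> c"
  proof -
    have "\<theta> powr \<eta> = 1 / R powr (2 * \<kappa> * \<eta>)" unfolding \<theta>_def powr_powr mult_minus_left by (rule powr_minus_divide)
    also have "\<dots> \<le> 1 / (1 / c)" using R(4,5) c by (intro divide_left_mono) auto
    finally show ?thesis by simp
  qed
  have \<theta>1: "\<theta> < 1"
  proof -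
    have "1 < R powr (2 * \<kappa>)" using R(5) \<kappa> by (intro gr_one_powr) auto
    then show ?thesis by (simp add: \<theta>_def powr_minus inverse_less_1_iff)
  qed

  \<comment> \<open>Collects the constants of \<open>term_le\<close>, so that a cover of
    \<open>s\<close>-mass below \<open>1 / K\<close> has total weight below 1.\<close>
  define K where "K = 4 ^ mn / (W0 * c)"
  have K: "0 < K" using W0 c by (simp add: K_def)
  have K': "0 < min 1 (1 / K)" "min 1 (1 / K) \<le> 1" using K by auto
  obtain ctr r where r: "\<And>i. 0 < r i" "\<And>i. r i \<le> 1" "summable (\<lambda>i. r i powr s)"
    "(\<Sum>i. r i powr s) < min 1 (1 / K)"
    and cover: "{\<Theta>. badly_approximable \<alpha> \<beta> \<Theta>} \<inter> U \<subseteq> (\<Union>i. cball (ctr i) (r i))"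
    by (rule null_set_cover[OF null s(1) K']) blast
  \<comment> \<open>The witness is the first level with all sides at most \<open>r i\<close>. One
    level earlier some side exceeds \<open>r i\<close>, hence \<open>r i \<le> \<theta> ^ l\<close>
    and \<open>r i powr \<eta> \<le> c ^ l\<close>; the factor \<open>c\<close> on the left accounts
    for this shift.\<close>
  have "\<exists>k. (\<forall>e. w k e \<le> r i) \<and> c * r i powr \<eta> \<le> c ^ k" for i
  proof -
    define P where "P k \<longleftrightarrow> (\<forall>e. w k e \<le> r i)" for k
    obtain k0 where "\<theta> ^ k0 < r i" using real_arch_pow_inv[OF r(1) \<theta>1] by blast
    then have "w k0 e \<le> r i" for e using w_le[of k0 e] by linarith
    then have "P k0" unfolding P_def by blast
    define k where "k = (LEAST k. P k)"
    have Pk: "P k" unfolding k_def using \<open>P k0\<close> by (rule LeastI)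
    have "c * r i powr \<eta> \<le> c ^ k"
    proof (cases k)
      case 0
      have "r i powr \<eta> \<le> 1" using r(1,2)[of i] \<eta> by (intro powr_le1) auto
      then have "c * r i powr \<eta> \<le> 1 * 1" using c by (intro mult_mono) auto
      then show ?thesis by (simp add: 0)
    next
      case (Suc l)
      then have "\<not> P l" using not_less_Least[of l P] by (simp add: k_def)
      then obtain e where "r i < w l e" by (auto simp: P_def not_le)
      then have "r i \<le> \<theta> ^ l" using w_le[of l e] by linarith
      then have "r i powr \<eta> \<le> (\<theta> ^ l) powr \<eta>" using r(1)[of i] \<eta> by (intro powr_mono2) auto
      also have "\<dots> = (\<theta> powr \<eta>) ^ l" using \<theta> by (simp add: powr_realpow[symmetric] powr_powr mult.commute)
      also have "\<dots> \<le> c ^ l" using \<theta>\<eta> by (intro power_mono) auto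
      finally show ?thesis using c by (simp add: Suc)
    qed
    then show ?thesis using Pk by (auto simp: P_def)
  qed
  then have "\<exists>lev. \<forall>i. (\<forall>e. w (lev i) e \<le> r i) \<and> c * r i powr \<eta> \<le> c ^ lev i" by (intro choice allI)
  then obtain lev where lev: "\<And>i e. w (lev i) e \<le> r i" "\<And>i. c * r i powr \<eta> \<le> c ^ lev i" by blast
  have term_le: "(4 * r i) ^ mn / W (lev i) \<le> K * r i powr s" for i
  proof -
    have "W0 * (c * r i powr \<eta>) \<le> W0 * c ^ lev i" using lev(2) W0 by (intro mult_left_mono) auto
    then have le: "W0 * (c * r i powr \<eta>) \<le> W (lev i)" using W_ge[of "lev i"] by linarith
    have pos: "0 < W0 * (c * r i powr \<eta>)" using W0 c r(1)[of i] by simp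
    then have "0 < W (lev i)" using le by linarith
    then have "(4 * r i) ^ mn / W (lev i) \<le> (4 * r i) ^ mn / (W0 * (c * r i powr \<eta>))"
      using r(1)[of i] by (intro divide_left_mono le mult_pos_pos[OF _ pos]) auto
    also have "\<dots> = K * (r i ^ mn / r i powr \<eta>)" by (simp add: K_def power_mult_distrib)
    also have "r i ^ mn / r i powr \<eta> = r i powr s"
      using r(1)[of i] by (simp add: \<eta>_def powr_diff powr_realpow)
    finally show ?thesis .
  qed
  have W_pos: "0 < W k" for k unfolding W_def using w M by (intro mult_pos_pos prod_pos) auto
  have summ: "summable (\<lambda>i. (4 * r i) ^ mn / W (lev i))"
    by (rule summable_comparison_test'[OF summable_mult[OF r(3), of K], of 0])
      (use term_le r(1) W_pos in \<open>auto simp: abs_of_nonneg less_imp_le\<close>)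
  have "(\<Sum>i. (4 * r i) ^ mn / W (lev i)) \<le> (\<Sum>i. K * r i powr s)"
    by (intro suminf_le term_le summ summable_mult r(3))
  also have "\<dots> = K * (\<Sum>i. r i powr s)" by (rule suminf_mult[OF r(3)])
  also have "\<dots> < K * (1 / K)" using r(4) K by (intro mult_strict_left_mono) auto
  finally have small_sum: "(\<Sum>i. (4 * r i) ^ mn / W (lev i)) < 1" using K by simp

  define x0 where "x0 = (\<lambda>(i, j). \<Theta>0 $ i $ j)"
  define u where "u k = (\<lambda>(i, j). ctr k $ i $ j)" for k
  have "\<exists>z x. x 0 = x0 \<and> (\<forall>k. no_short_vector \<epsilon> (A k) (B k) (x k) \<and> (\<forall>e. x k e \<le> z e \<and> z e \<le> x k e + w k e))
    \<and> (\<forall>i. \<exists>e. r i < \<bar>z e - u i e\<bar>)"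
  proof (rule nested_boxes_avoid[where N=N and M=M and W="\<lambda>i. W (lev i)" and \<kappa>=lev])
    show "no_short_vector \<epsilon> (A 0) (B 0) x0"
      unfolding no_short_vector_def
    proof (intro allI impI, elim conjE)
      fix q p
      assume p: "\<forall>i. \<bar>(\<Sum>j\<in>UNIV. x0 (i, j) * real_of_int (q j)) + real_of_int (p i)\<bar> < \<epsilon> * A 0 i"
        and q: "\<forall>j. \<bar>real_of_int (q j)\<bar> < \<epsilon> * B 0 j"
      have q0: "q j = 0" for j
      proof -
        have "\<epsilon> * B 0 j \<le> \<epsilon> * b1" using \<beta>b1[of j] \<epsilon> by (simp add: B_def T_def)
        then have "\<bar>real_of_int (q j)\<bar> < 1" using q[rule_format, of j] \<epsilon>(3) by linarith
        then show ?thesis by linarith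
      qed
      moreover have "p i = 0" for i
      proof -
        have "\<epsilon> * A 0 i \<le> 1 * 1" using \<epsilon> A[of 0 i] A1[of 0 i] by (intro mult_mono) auto
        then have "\<bar>real_of_int (p i)\<bar> < 1" using p[rule_format, of i] q0 by simp
        then show ?thesis by linarith
      qed
      ultimately show "(\<forall>j. q j = 0) \<and> (\<forall>i. p i = 0)" by blast
    qed
  next
    fix k x assume "no_short_vector \<epsilon> (A k) (B k) x"
    then have hyp: "(\<forall>i. 0 < A k i) \<and> (\<forall>j. 0 < B k j) \<and> (\<Prod>i\<in>UNIV. A k i) * (\<Prod>j\<in>UNIV. B k j) = 1 \<and>
      (\<forall>i. L \<le> a k i) \<and> (\<forall>j. L \<le> b k j) \<and> (\<Prod>i\<in>UNIV. a k i) = (\<Prod>j\<in>UNIV. b k j) \<and> L \<le> (\<Prod>j\<in>UNIV. b k j) \<and>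
      no_short_vector \<epsilon> (A k) (B k) x"
      using A B covol aL bL a_prod b_prod R(2) by auto
    show "M k \<le> real (card {D \<in> digits (N k). no_short_vector \<epsilon> (A (Suc k)) (B (Suc k)) (child x (w (Suc k)) D)})"
      using half[OF hyp] by (simp add: Aa Bb M_def N_def w_def)
  qed (use w N_w M lev(1) summ small_sum in \<open>simp_all add: W_def mn_def\<close>)
  then obtain z x where x0: "x 0 = x0" and x: "\<And>k. no_short_vector \<epsilon> (A k) (B k) (x k)"
    "\<And>k e. x k e \<le> z e" "\<And>k e. z e \<le> x k e + w k e" and avoid: "\<And>i. \<exists>e. r i < \<bar>z e - u i e\<bar>"
    by blast
  define \<Theta> :: "real^'n^'m" where "\<Theta> = (\<chi> i j. z (i, j))"
  have z_eq: "(\<lambda>(i, j). \<Theta> $ i $ j) = z" by (auto simp: \<Theta>_def)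
  have "badly_approximable \<alpha> \<beta> \<Theta>"
  proof (rule badly_approximableI[OF R(1) _ \<epsilon>'])
    fix k
    have "\<bar>z (i, j) - x k (i, j)\<bar> \<le> A k i / B k j" for i j
      using x(2)[of k "(i, j)"] x(3)[of "(i, j)" k] by (simp add: w_def)
    then have "no_short_vector \<epsilon>' (A k) (B k) z"
      unfolding \<epsilon>'_def by (rule no_short_vector_perturb[OF x(1) \<epsilon>(1) A B])
    then show "no_short_vector \<epsilon>' (\<lambda>i. \<alpha> i (1 / (R ^ k * T0))) (\<lambda>j. \<beta> j (R ^ k * T0)) (\<lambda>(i, j). \<Theta> $ i $ j)"
      unfolding z_eq by (simp add: A_def[abs_def] B_def[abs_def] T_def)
  qed (use T0 R in auto)
  moreover have "\<Theta> \<in> U"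
  proof -
    have "norm (\<Theta> - \<Theta>0) \<le> real mn * (1 / T0 powr \<kappa>)"
      unfolding mn_def
    proof (rule norm_matrix_le)
      fix i j
      show "\<bar>(\<Theta> - \<Theta>0) $ i $ j\<bar> \<le> 1 / T0 powr \<kappa>"
        using x(2)[of 0 "(i, j)"] x(3)[of "(i, j)" 0] w0[of "(i, j)"] by (simp add: x0 x0_def \<Theta>_def)
    qed
    also have "\<dots> < \<delta>" using T0(1,3) \<delta>(1) by (simp add: field_simps)
    finally show ?thesis using \<delta>(2) by (auto simp: dist_norm norm_minus_commute)
  qed
  \<comment> \<open>The covering ball is Euclidean while avoidance holds in one coordinate; a
    coordinate never exceeds the norm, so the two contradict each other.\<close>
  ultimately obtain i where i: "dist (ctr i) \<Theta> \<le> r i" using cover by auto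
  obtain e where e: "r i < \<bar>z e - u i e\<bar>" using avoid by blast
  obtain i' j' where ij: "e = (i', j')" by (cases e)
  have "\<bar>(\<Theta> - ctr i) $ i' $ j'\<bar> \<le> norm ((\<Theta> - ctr i) $ i')" by (rule component_le_norm_cart)
  also have "\<dots> \<le> norm (\<Theta> - ctr i)" by (rule Finite_Cartesian_Product.norm_nth_le)
  finally show False using e i by (simp add: ij u_def \<Theta>_def dist_norm norm_minus_commute)
qed

lemma thick_badly_approximable: "thick {\<Theta> :: real^'n^'m. badly_approximable \<alpha> \<beta> \<Theta>}"
  unfolding thick_def
proof (intro allI impI, elim conjE)
  fix U :: "(real^'n^'m) set" assume U: "open U" "U \<noteq> {}"
  define S where "S = {\<Theta> :: real^'n^'m. badly_approximable \<alpha> \<beta> \<Theta>} \<inter> U"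
  define d where "d = real (CARD('m) * CARD('n))"
  have d0: "0 \<le> d" by (simp add: d_def)
  have "hausdorff_dim S \<le> ennreal d"
  proof (rule ennreal_le_epsilon)
    fix e :: real assume "0 < e"
    then have "hausdorff_measure (d + e) S = 0" by (intro hausdorff_measure_eq_0) (simp add: d_def)
    then have "hausdorff_dim S \<le> ennreal (d + e)"
      unfolding hausdorff_dim_def using \<open>0 < e\<close> d0 by (intro Inf_lower CollectI exI[of _ "d + e"]) auto
    then show "hausdorff_dim S \<le> ennreal d + ennreal e" using \<open>0 < e\<close> d0 by (simp add: ennreal_plus)
  qed
  moreover have "ennreal d \<le> hausdorff_dim S"
    unfolding hausdorff_dim_def
  proof (rule Inf_greatest, clarify)
    fix s :: real assume "0 < s" "hausdorff_measure s S = 0"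
    then have "\<not> s < d" using hausdorff_measure_badly_approximable[OF U, of s] by (auto simp: S_def d_def)
    then show "ennreal d \<le> ennreal s" by (intro ennreal_leI) simp
  qed
  ultimately have "hausdorff_dim S = ennreal d" by (rule antisym)
  then show "hausdorff_dim ({\<Theta> :: real^'n^'m. badly_approximable \<alpha> \<beta> \<Theta>} \<inter> U) = of_nat (CARD('m) * CARD('n))"
    by (simp only: S_def d_def ennreal_of_nat_eq_real_of_nat)
qed

end

theorem theorem1p5:
  fixes \<alpha> :: "'m::finite \<Rightarrow> real \<Rightarrow> real"
    and \<beta> :: "'n::finite \<Rightarrow> real \<Rightarrow> real"
  assumes "\<And>i. bij_betw (\<alpha> i) {0<..1} {0<..1}"
    and "\<And>i. mono_on {0<..1} (\<alpha> i)"
    and "\<And>i. quasimultiplicative_on {0<..1} (\<alpha> i)"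
    and "\<And>j. bij_betw (\<beta> j) {1..} {1..}"
    and "\<And>j. mono_on {1..} (\<beta> j)"
    and "\<And>j. quasimultiplicative_on {1..} (\<beta> j)"
    and "\<And>T. T \<ge> 1 \<Longrightarrow> (\<Prod>i\<in>UNIV. \<alpha> i (1 / T)) = 1 / T"
    and "\<And>T. T \<ge> 1 \<Longrightarrow> (\<Prod>j\<in>UNIV. \<beta> j T) = T"
  shows "thick {\<Theta> :: real^'n^'m. badly_approximable \<alpha> \<beta> \<Theta>}"
proof -
  obtain Ra \<kappa>a where a: "1 < Ra" "0 < \<kappa>a"
    "\<And>i R t. Ra \<le> R \<Longrightarrow> t \<in> {0<..1} \<Longrightarrow> R * t \<in> {0<..1} \<Longrightarrow> R powr \<kappa>a * \<alpha> i t \<le> \<alpha> i (R * t)"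
    using quasimultiplicative_family_growth[of "{0<..1}" \<alpha>, OF assms(3)] by blast
  obtain Rb \<kappa>b where b: "1 < Rb" "0 < \<kappa>b"
    "\<And>j R T. Rb \<le> R \<Longrightarrow> T \<in> {1..} \<Longrightarrow> R * T \<in> {1..} \<Longrightarrow> R powr \<kappa>b * \<beta> j T \<le> \<beta> j (R * T)"
    using quasimultiplicative_family_growth[of "{1..}" \<beta>, OF assms(6)] by blast
  have \<alpha>_range: "\<alpha> i t \<in> {0<..1}" if "0 < t" "t \<le> 1" for i t
    using bij_betw_apply[OF assms(1)] that by auto
  have \<beta>_range: "\<beta> j T \<in> {1..}" if "1 \<le> T" for j T
    using bij_betw_apply[OF assms(4)] that by auto
  define \<kappa> where "\<kappa> = min \<kappa>a \<kappa>b"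
  define R0 where "R0 = max Ra Rb"
  interpret weight_functions \<alpha> \<beta> \<kappa> R0
  proof
    fix i and t R :: real assume R: "R0 \<le> R" and t: "0 < t" "R * t \<le> 1"
    have R1: "1 < R" "Ra \<le> R" using R a by (auto simp: R0_def)
    have "1 * t \<le> R * t" using R1 t by (intro mult_right_mono) auto
    then have t1: "t \<le> 1" using t by linarith
    have "R powr \<kappa> * \<alpha> i t \<le> R powr \<kappa>a * \<alpha> i t"
      using R1 \<alpha>_range[OF t(1) t1, of i] by (intro mult_right_mono powr_mono) (auto simp: \<kappa>_def)
    also have "\<dots> \<le> \<alpha> i (R * t)" using R1 t t1 by (intro a(3)) auto
    finally show "R powr \<kappa> * \<alpha> i t \<le> \<alpha> i (R * t)" .
  next
    fix j and T R :: real assume R: "R0 \<le> R" and T: "1 \<le> T"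
    have R1: "1 < R" "Rb \<le> R" using R b by (auto simp: R0_def)
    have RT: "1 \<le> R * T" using R1 T mult_mono[of 1 R 1 T] by simp
    have "R powr \<kappa> * \<beta> j T \<le> R powr \<kappa>b * \<beta> j T"
      using R1 \<beta>_range[OF T, of j] by (intro mult_right_mono powr_mono) (auto simp: \<kappa>_def)
    also have "\<dots> \<le> \<beta> j (R * T)" using R1 T RT by (intro b(3)) auto
    finally show "R powr \<kappa> * \<beta> j T \<le> \<beta> j (R * T)" .
  qed (use assms(2,5,7,8) a b \<alpha>_range \<beta>_range in \<open>auto simp: mono_on_def \<kappa>_def R0_def\<close>)
  show ?thesis by (rule thick_badly_approximable)
qed

end
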